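(* Let $S$ be an inverse semigroup with zero. Then $S$ is isomorphic to the graph inverse semigroup $P_G$ of some directed graph $G$ if and only if $S$ is a combinatorial proper Perrot semigroup.
   Context: Directed graphs and $P_G$: a directed graph $G$ consists of a set of vertices $G_0$, a set of edges $G_1$ and maps $\mathbf{d},\mathbf{r}\colon G_1\to G_0$ (domain and range). A path is either an empty path $1_v$ at a vertex $v$ (with $\mathbf{d}(1_v)=\mathbf{r}(1_v)=v$) or a sequence of edges $x=x_1\cdots x_n$, $n\ge 1$, with $\mathbf{d}(x_i)=\mathbf{r}(x_{i+1})$ for all $i$; then $\mathbf{r}(x)=\mathbf{r}(x_1)$ and $\mathbf{d}(x)=\mathbf{d}(x_n)$. The free category $G^{*}$ is the set of all paths under concatenation, where $xy$ is defined iff $\mathbf{d}(x)=\mathbf{r}(y)$. The graph inverse semigroup $P_G$ consists of a zero $0$ and the formal elements $xy^{-1}$ with $x,y\in G^{*}$, $\mathbf{d}(x)=\mathbf{d}(y)$, with product $xy^{-1}\cdot uv^{-1}=xzv^{-1}$ if $u=yz$ for some path $z$; $=x(vz)^{-1}$ if $y=uz$ for some path $z$; and $=0$ otherwise. Perrot semigroups: let $S$ be an inverse semigroup with zero, $E(S)$ its semilattice of idempotents, $\le$ the natural partial order. A poset $X$ with zero is unambiguous if for all $x,y\in X$, whenever there is a nonzero $z\le x,y$, then $x\le y$ or $y\le x$. $S$ is a Perrot semigroup if: (P1) $E(S)$ is unambiguous; (P2) for each nonzero idempotent $e$ the set $\{f\in E(S): e\le f\}$ is finite; (P3) each nonzero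 idempotent lies beneath a unique maximal idempotent; (P4) each nonzero $\mathscr{D}$-class contains a maximal idempotent. It is proper if each nonzero $\mathscr{D}$-class contains a unique maximal idempotent. $S$ is combinatorial if Green's relation $\mathscr{H}$ is equality. *)

theory Defs
  imports Graph_Theory.Digraph "HOL-Algebra.Congruence"
begin

section \<open>Inverse semigroups with zero\<close>

record 'a semigroup_zero = "'a partial_object" +
  sg_mult :: "'a \<Rightarrow> 'a \<Rightarrow> 'a" (infixl "\<cdot>\<index>" 70)
  sg_zero :: 'a ("\<bbbzero>\<index>")

text \<open>The trivial semigroup, in which the zero is the only element, is allowed.\<close>

locale inverse_semigroup_zero =
  fixes S :: "('a, 'b) semigroup_zero_scheme" (structure)
  assumes mult_closed: "\<lbrakk>a \<in> carrier S; b \<in> carrier S\<rbrakk> \<Longrightarrow> a \<cdot> b \<in> carrier S"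
    and mult_assoc: "\<lbrakk>a \<in> carrier S; b \<in> carrier S; c \<in> carrier S\<rbrakk>
      \<Longrightarrow> (a \<cdot> b) \<cdot> c = a \<cdot> (b \<cdot> c)"
    and unique_inverse: "a \<in> carrier S \<Longrightarrow> \<exists>!b. b \<in> carrier S \<and> a \<cdot> b \<cdot> a = a \<and> b \<cdot> a \<cdot> b = b"
    and zero_closed: "\<bbbzero> \<in> carrier S"
    and zero_left: "a \<in> carrier S \<Longrightarrow> \<bbbzero> \<cdot> a = \<bbbzero>"
    and zero_right: "a \<in> carrier S \<Longrightarrow> a \<cdot> \<bbbzero> = \<bbbzero>"

definition semigroup_isomorphic ::
    "('a, 'c) semigroup_zero_scheme \<Rightarrow> ('b, 'd) semigroup_zero_scheme \<Rightarrow> bool" where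
  "semigroup_isomorphic S T \<longleftrightarrow>
    (\<exists>h. bij_betw h (carrier S) (carrier T) \<and>
      (\<forall>a \<in> carrier S. \<forall>b \<in> carrier S. h (a \<cdot>\<^bsub>S\<^esub> b) = h a \<cdot>\<^bsub>T\<^esub> h b))"

definition idempotents :: "('a, 'b) semigroup_zero_scheme \<Rightarrow> 'a set" where
  "idempotents S = {e \<in> carrier S. e \<cdot>\<^bsub>S\<^esub> e = e}"

definition natural_le :: "('a, 'b) semigroup_zero_scheme \<Rightarrow> 'a \<Rightarrow> 'a \<Rightarrow> bool" where
  "natural_le S a b \<longleftrightarrow>
    a \<in> carrier S \<and> b \<in> carrier S \<and> (\<exists>e \<in> idempotents S. a = b \<cdot>\<^bsub>S\<^esub> e)"

definition maximal_idempotent :: "('a, 'b) semigroup_zero_scheme \<Rightarrow> 'a \<Rightarrow> bool" where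
  "maximal_idempotent S e \<longleftrightarrow>
    e \<in> idempotents S \<and> (\<forall>f \<in> idempotents S. natural_le S e f \<longrightarrow> f = e)"


section \<open>Green's relations\<close>

text \<open>The principal one-sided ideals are those generated in \<open>S\<close> with an identity adjoined.\<close>

definition left_ideal :: "('a, 'b) semigroup_zero_scheme \<Rightarrow> 'a \<Rightarrow> 'a set" where
  "left_ideal S a = insert a {s \<cdot>\<^bsub>S\<^esub> a | s. s \<in> carrier S}"

definition right_ideal :: "('a, 'b) semigroup_zero_scheme \<Rightarrow> 'a \<Rightarrow> 'a set" where
  "right_ideal S a = insert a {a \<cdot>\<^bsub>S\<^esub> s | s. s \<in> carrier S}"

definition green_L :: "('a, 'b) semigroup_zero_scheme \<Rightarrow> 'a rel" where
  "green_L S = {(a, b). a \<in> carrier S \<and> b \<in> carrier S \<and> left_ideal S a = left_ideal S b}"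

definition green_R :: "('a, 'b) semigroup_zero_scheme \<Rightarrow> 'a rel" where
  "green_R S = {(a, b). a \<in> carrier S \<and> b \<in> carrier S \<and> right_ideal S a = right_ideal S b}"

definition green_H :: "('a, 'b) semigroup_zero_scheme \<Rightarrow> 'a rel" where
  "green_H S = green_L S \<inter> green_R S"

definition green_D :: "('a, 'b) semigroup_zero_scheme \<Rightarrow> 'a rel" where
  "green_D S = green_L S O green_R S"

text \<open>The zero forms a \<open>D\<close>-class on its own, so the nonzero classes are those other
  than the singleton of the zero.\<close>

definition nonzero_D_classes :: "('a, 'b) semigroup_zero_scheme \<Rightarrow> 'a set set" where
  "nonzero_D_classes S = carrier S // green_D S - {{\<bbbzero>\<^bsub>S\<^esub>}}"

definition combinatorial :: "('a, 'b) semigroup_zero_scheme \<Rightarrow> bool" where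
  "combinatorial S \<longleftrightarrow> green_H S = Id_on (carrier S)"


section \<open>Perrot semigroups\<close>

definition unambiguous :: "'a set \<Rightarrow> ('a \<Rightarrow> 'a \<Rightarrow> bool) \<Rightarrow> 'a \<Rightarrow> bool" where
  "unambiguous X le z0 \<longleftrightarrow>
    (\<forall>x \<in> X. \<forall>y \<in> X. (\<exists>z \<in> X. z \<noteq> z0 \<and> le z x \<and> le z y) \<longrightarrow> le x y \<or> le y x)"

locale perrot_semigroup = inverse_semigroup_zero +
  assumes P1: "unambiguous (idempotents S) (natural_le S) \<bbbzero>"
    and P2: "\<lbrakk>e \<in> idempotents S; e \<noteq> \<bbbzero>\<rbrakk> \<Longrightarrow> finite {f \<in> idempotents S. natural_le S e f}"
    and P3: "\<lbrakk>e \<in> idempotents S; e \<noteq> \<bbbzero>\<rbrakk>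
      \<Longrightarrow> \<exists>!m. maximal_idempotent S m \<and> natural_le S e m"
    and P4: "C \<in> nonzero_D_classes S \<Longrightarrow> \<exists>m \<in> C. maximal_idempotent S m"

locale proper_perrot_semigroup = perrot_semigroup +
  assumes proper: "C \<in> nonzero_D_classes S \<Longrightarrow> \<exists>!m. m \<in> C \<and> maximal_idempotent S m"


section \<open>The free category of a directed graph\<close>

text \<open>The domain and range of an edge are its tail and head. Paths are written in the order of
  composition of functions, \<open>x\<^sub>1 \<cdots> x\<^sub>n\<close> with the domain of
  \<open>x\<^sub>i\<close> equal to the range of \<open>x\<^sub>i\<^sub>+\<^sub>1\<close>, which is the
  reverse of the order used for walks in the
  graph library.\<close>

datatype ('v, 'e) path = Empty_Path 'v | Edge_Path "'e list"

fun path_dom :: "('v, 'e) pre_digraph \<Rightarrow> ('v, 'e) path \<Rightarrow> 'v" where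
  "path_dom G (Empty_Path v) = v"
| "path_dom G (Edge_Path es) = tail G (last es)"

fun path_ran :: "('v, 'e) pre_digraph \<Rightarrow> ('v, 'e) path \<Rightarrow> 'v" where
  "path_ran G (Empty_Path v) = v"
| "path_ran G (Edge_Path es) = head G (hd es)"

fun is_path :: "('v, 'e) pre_digraph \<Rightarrow> ('v, 'e) path \<Rightarrow> bool" where
  "is_path G (Empty_Path v) \<longleftrightarrow> v \<in> verts G"
| "is_path G (Edge_Path es) \<longleftrightarrow> es \<noteq> [] \<and> set es \<subseteq> arcs G \<and>
    (\<forall>i. Suc i < length es \<longrightarrow> tail G (es ! i) = head G (es ! Suc i))"

text \<open>The result is meaningful only if the domain of the first path is the range of the
  second.\<close>

fun path_comp :: "('v, 'e) path \<Rightarrow> ('v, 'e) path \<Rightarrow> ('v, 'e) path" (infixl "\<bullet>" 75) where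
  "Empty_Path v \<bullet> q = q"
| "Edge_Path es \<bullet> Empty_Path v = Edge_Path es"
| "Edge_Path es \<bullet> Edge_Path fs = Edge_Path (es @ fs)"

text \<open>The path \<open>z\<close> with \<open>u = y z\<close> in the free category; it is
  unique whenever it exists.\<close>

definition is_residual ::
    "('v, 'e) pre_digraph \<Rightarrow> ('v, 'e) path \<Rightarrow> ('v, 'e) path \<Rightarrow> ('v, 'e) path \<Rightarrow> bool" where
  "is_residual G u y z \<longleftrightarrow> is_path G z \<and> path_dom G y = path_ran G z \<and> u = y \<bullet> z"


section \<open>The graph inverse semigroup\<close>

text \<open>\<open>Frac x y\<close> is the formal element \<open>x y\<inverse>\<close>.\<close>

datatype ('v, 'e) gis = Zero | Frac "('v, 'e) path" "('v, 'e) path"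

fun gis_mult :: "('v, 'e) pre_digraph \<Rightarrow> ('v, 'e) gis \<Rightarrow> ('v, 'e) gis \<Rightarrow> ('v, 'e) gis" where
  "gis_mult G (Frac x y) (Frac u v) =
    (if \<exists>z. is_residual G u y z then Frac (x \<bullet> (THE z. is_residual G u y z)) v
     else if \<exists>z. is_residual G y u z then Frac x (v \<bullet> (THE z. is_residual G y u z))
     else Zero)"
| "gis_mult G Zero b = Zero"
| "gis_mult G a Zero = Zero"

definition graph_inverse_semigroup ::
    "('v, 'e) pre_digraph \<Rightarrow> ('v, 'e) gis semigroup_zero" where
  "graph_inverse_semigroup G =
    \<lparr>carrier = insert Zero
       {Frac x y | x y. is_path G x \<and> is_path G y \<and> path_dom G x = path_dom G y},
     sg_mult = gis_mult G,
     sg_zero = Zero\<rparr>"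

end

theory Submission
  imports Defs
begin

text \<open>
  In \<open>P\<^sub>G\<close> the nonzero idempotents are the \<open>x x\<inverse>\<close>, ordered by reverse
  prefix order, the maximal ones are the empty paths, and the \<open>D\<close>-class of
  \<open>x y\<inverse>\<close> is determined by the common domain of \<open>x\<close> and \<open>y\<close>.

  Conversely, in a combinatorial proper Perrot semigroup call \<open>x \<noteq> 0\<close> a path element if
  \<open>x\<inverse> x\<close> is maximal. Every nonzero idempotent is \<open>x x\<inverse>\<close> for
  exactly one path element \<open>x\<close>: existence is (P4), and uniqueness holds because properness
  forces the domains to agree and then combinatoriality applies. The vertices of the graph are
  the nonzero maximal idempotents, and the edges are the path elements \<open>x\<close> such that only
  maximal idempotents lie strictly above \<open>x x\<inverse>\<close>. By (P2) each path element is a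
  product of edges along a path, and by (P1) this factorisation is unique, so that
  \<open>x y\<inverse>\<close> can be sent to the corresponding quotient of products.
\<close>

section \<open>Inverse semigroups\<close>

context inverse_semigroup_zero
begin

text \<open>The description is well defined on the carrier because the inverse is unique
  there.\<close>

definition sinv :: "'a \<Rightarrow> 'a" where
  "sinv a = (THE b. b \<in> carrier S \<and> a \<cdot> b \<cdot> a = a \<and> b \<cdot> a \<cdot> b = b)"

lemma
  assumes "a \<in> carrier S"
  shows sinv_closed: "sinv a \<in> carrier S"
    and mult_sinv_mult: "a \<cdot> (sinv a \<cdot> a) = a"
    and sinv_mult_sinv: "sinv a \<cdot> (a \<cdot> sinv a) = sinv a"
  using theI'[OF unique_inverse[OF assms]] assms
  unfolding sinv_def[symmetric] by (auto simp: mult_assoc)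

lemmas closed = mult_closed sinv_closed

lemma sinv_eqI:
  assumes "a \<in> carrier S" "b \<in> carrier S" "a \<cdot> (b \<cdot> a) = a" "b \<cdot> (a \<cdot> b) = b"
  shows "sinv a = b"
  unfolding sinv_def
  by (rule the1_equality[OF unique_inverse]) (use assms in \<open>auto simp: mult_assoc\<close>)

lemma sinv_sinv [simp]: "a \<in> carrier S \<Longrightarrow> sinv (sinv a) = a"
  by (rule sinv_eqI) (auto simp: closed mult_sinv_mult sinv_mult_sinv)

lemma
  assumes "a \<in> carrier S" "b \<in> carrier S"
  shows mult_sinv_mult_left: "a \<cdot> (sinv a \<cdot> (a \<cdot> b)) = a \<cdot> b"
    and sinv_mult_sinv_left: "sinv a \<cdot> (a \<cdot> (sinv a \<cdot> b)) = sinv a \<cdot> b"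
  using mult_sinv_mult[OF assms(1)] sinv_mult_sinv[OF assms(1)] assms
  by (metis mult_assoc mult_closed sinv_closed)+

lemma idempotentsI: "e \<in> carrier S \<Longrightarrow> e \<cdot> e = e \<Longrightarrow> e \<in> idempotents S"
  by (simp add: idempotents_def)

lemma
  assumes "e \<in> idempotents S"
  shows idem_closed: "e \<in> carrier S" and idem_mult: "e \<cdot> e = e"
  using assms by (auto simp: idempotents_def)

lemma idem_mult_left: "e \<in> idempotents S \<Longrightarrow> a \<in> carrier S \<Longrightarrow> e \<cdot> (e \<cdot> a) = e \<cdot> a"
  by (metis idem_closed idem_mult mult_assoc)

lemma sinv_idem: "e \<in> idempotents S \<Longrightarrow> sinv e = e"
  by (rule sinv_eqI) (auto simp: idem_closed idem_mult)

lemma zero_idem: "\<bbbzero> \<in> idempotents S"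
  by (simp add: idempotentsI zero_closed zero_left)

lemma
  assumes "a \<in> carrier S"
  shows mult_sinv_idem: "a \<cdot> sinv a \<in> idempotents S"
    and sinv_mult_idem: "sinv a \<cdot> a \<in> idempotents S"
  using assms
  by (auto intro!: idempotentsI simp: closed mult_assoc mult_sinv_mult sinv_mult_sinv)

text \<open>If \<open>x\<close> is the inverse of \<open>e \<cdot> f\<close>, then
  \<open>f \<cdot> (x \<cdot> e)\<close> is an inverse of it as well, so both agree by uniqueness.
  This form makes \<open>x\<close> idempotent, hence its own inverse, hence equal to
  \<open>e \<cdot> f\<close>.\<close>

lemma idem_mult_closed:
  assumes "e \<in> idempotents S" "f \<in> idempotents S"
  shows "e \<cdot> f \<in> idempotents S"
proof -
  note c = assms[THEN idem_closed]
  define x where "x = sinv (e \<cdot> f)"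
  have xc: "x \<in> carrier S"
    using c by (simp add: x_def closed)
  have x1: "x \<cdot> (e \<cdot> (f \<cdot> x)) = x"
    using sinv_mult_sinv[of "e \<cdot> f"] c xc by (simp add: x_def mult_assoc closed)
  have x2: "e \<cdot> (f \<cdot> (x \<cdot> (e \<cdot> f))) = e \<cdot> f"
    using mult_sinv_mult[of "e \<cdot> f"] c xc by (simp add: x_def mult_assoc closed)
  have x1': "x \<cdot> (e \<cdot> (f \<cdot> (x \<cdot> e))) = x \<cdot> e"
    using arg_cong[OF x1, of "\<lambda>y. y \<cdot> e"] c xc by (simp add: mult_assoc closed)
  have "sinv (e \<cdot> f) = f \<cdot> (x \<cdot> e)"
    by (rule sinv_eqI)
       (use c xc x1' x2 assms in \<open>simp_all add: closed mult_assoc idem_mult_left\<close>)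
  then have x: "x = f \<cdot> (x \<cdot> e)"
    by (simp add: x_def)
  have "x \<cdot> x = (f \<cdot> (x \<cdot> e)) \<cdot> (f \<cdot> (x \<cdot> e))"
    using x by simp
  also have "\<dots> = f \<cdot> (x \<cdot> e)"
    using c xc x1' by (simp add: mult_assoc closed)
  finally have "x \<in> idempotents S"
    using x xc by (simp add: idempotentsI)
  moreover from this have "x = sinv x"
    by (simp add: sinv_idem)
  moreover have "sinv x = e \<cdot> f"
    using c by (simp add: x_def closed)
  ultimately show ?thesis by simp
qed

text \<open>Both products are idempotent, which makes \<open>f \<cdot> e\<close> an inverse of
  \<open>e \<cdot> f\<close>; an idempotent is also its own inverse.\<close>

lemma idem_commute:
  assumes "e \<in> idempotents S" "f \<in> idempotents S"
  shows "e \<cdot> f = f \<cdot> e"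
proof -
  note c = assms[THEN idem_closed]
  note ef = idem_mult[OF idem_mult_closed[OF assms]]
    and fe = idem_mult[OF idem_mult_closed[OF assms(2,1)]]
  have "sinv (e \<cdot> f) = f \<cdot> e"
    by (rule sinv_eqI)
       (use c ef fe assms in \<open>simp_all add: closed mult_assoc idem_mult_left\<close>)
  then show ?thesis
    using sinv_idem[OF idem_mult_closed[OF assms]] by simp
qed

text \<open>The idempotents \<open>b \<cdot> sinv b\<close> and \<open>sinv a \<cdot> a\<close> meet
  in the middle of both products, and commuting them lets each be absorbed by its neighbour.\<close>

lemma sinv_mult:
  assumes "a \<in> carrier S" "b \<in> carrier S"
  shows "sinv (a \<cdot> b) = sinv b \<cdot> sinv a"
proof (rule sinv_eqI)
  have *: "(b \<cdot> sinv b) \<cdot> (sinv a \<cdot> a) = (sinv a \<cdot> a) \<cdot> (b \<cdot> sinv b)"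
    using assms by (simp add: idem_commute mult_sinv_idem sinv_mult_idem)
  have "a \<cdot> b \<cdot> (sinv b \<cdot> sinv a \<cdot> (a \<cdot> b)) = a \<cdot> ((b \<cdot> sinv b) \<cdot> (sinv a \<cdot> a)) \<cdot> b"
    using assms by (simp add: closed mult_assoc)
  also have "\<dots> = a \<cdot> b"
    unfolding * using assms
    by (simp add: closed mult_assoc mult_sinv_mult mult_sinv_mult_left)
  finally show "a \<cdot> b \<cdot> (sinv b \<cdot> sinv a \<cdot> (a \<cdot> b)) = a \<cdot> b" .
  have "sinv b \<cdot> sinv a \<cdot> (a \<cdot> b \<cdot> (sinv b \<cdot> sinv a))
      = sinv b \<cdot> ((sinv a \<cdot> a) \<cdot> (b \<cdot> sinv b)) \<cdot> sinv a"
    using assms by (simp add: closed mult_assoc)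
  also have "\<dots> = sinv b \<cdot> sinv a"
    unfolding *[symmetric] using assms
    by (simp add: closed mult_assoc sinv_mult_sinv sinv_mult_sinv_left)
  finally show "sinv b \<cdot> sinv a \<cdot> (a \<cdot> b \<cdot> (sinv b \<cdot> sinv a)) = sinv b \<cdot> sinv a" .
qed (use assms in \<open>simp_all add: closed\<close>)

lemma conj_idem:
  assumes "a \<in> carrier S" "e \<in> idempotents S"
  shows "a \<cdot> (e \<cdot> sinv a) \<in> idempotents S"
proof (rule idempotentsI)
  note c = idem_closed[OF assms(2)]
  have *: "e \<cdot> (sinv a \<cdot> a) = (sinv a \<cdot> a) \<cdot> e"
    using assms by (simp add: idem_commute sinv_mult_idem)
  have "a \<cdot> (e \<cdot> sinv a) \<cdot> (a \<cdot> (e \<cdot> sinv a)) = a \<cdot> (e \<cdot> (sinv a \<cdot> a)) \<cdot> (e \<cdot> sinv a)"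
    using assms c by (simp add: closed mult_assoc)
  also have "\<dots> = a \<cdot> (e \<cdot> sinv a)"
    unfolding * using assms c
    by (simp add: closed mult_assoc idem_mult_left mult_sinv_mult_left)
  finally show "a \<cdot> (e \<cdot> sinv a) \<cdot> (a \<cdot> (e \<cdot> sinv a)) = a \<cdot> (e \<cdot> sinv a)" .
qed (use assms idem_closed in \<open>simp add: closed\<close>)

section \<open>The order on idempotents and Green's relations as equations\<close>

lemma natural_le_idem_iff:
  assumes "e \<in> idempotents S" "f \<in> idempotents S"
  shows "natural_le S e f \<longleftrightarrow> f \<cdot> e = e"
proof
  assume "natural_le S e f"
  then obtain g where "g \<in> idempotents S" "e = f \<cdot> g"
    by (auto simp: natural_le_def)
  then show "f \<cdot> e = e"
    using assms by (simp add: idem_mult_left idem_closed)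
next
  assume "f \<cdot> e = e"
  then show "natural_le S e f"
    unfolding natural_le_def using assms idem_closed by (metis (no_types))
qed

text \<open>The right ideal of \<open>x\<close> consists of the elements fixed by left
  multiplication with \<open>x \<cdot> sinv x\<close>. If two such ideals agree, each of the two
  idempotents fixes the other, and commutativity makes them equal.\<close>

lemma green_R_iff:
  "(a, b) \<in> green_R S \<longleftrightarrow> a \<in> carrier S \<and> b \<in> carrier S \<and> a \<cdot> sinv a = b \<cdot> sinv b"
proof -
  have ideal: "right_ideal S x = {y \<in> carrier S. x \<cdot> sinv x \<cdot> y = y}"
    if x: "x \<in> carrier S" for x
  proof (intro equalityI subsetI)
    fix y assume "y \<in> right_ideal S x"
    then consider "y = x" | s where "s \<in> carrier S" "y = x \<cdot> s"
      by (auto simp: right_ideal_def)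
    then show "y \<in> {y \<in> carrier S. x \<cdot> sinv x \<cdot> y = y}"
      by cases (use x in \<open>simp_all add: closed mult_assoc mult_sinv_mult mult_sinv_mult_left\<close>)
  next
    fix y assume "y \<in> {y \<in> carrier S. x \<cdot> sinv x \<cdot> y = y}"
    then have "y = x \<cdot> (sinv x \<cdot> y)" "sinv x \<cdot> y \<in> carrier S"
      using x by (simp_all add: closed mult_assoc[symmetric])
    then show "y \<in> right_ideal S x"
      unfolding right_ideal_def by blast
  qed
  have "a \<cdot> sinv a = b \<cdot> sinv b"
    if ab: "a \<in> carrier S" "b \<in> carrier S" and eq: "right_ideal S a = right_ideal S b"
  proof -
    have "x \<cdot> sinv x \<in> right_ideal S x" if "x \<in> carrier S" for x
      using that by (simp add: ideal closed idem_mult mult_sinv_idem)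
    then have "a \<cdot> sinv a \<in> right_ideal S b" "b \<cdot> sinv b \<in> right_ideal S a"
      using ab eq by metis+
    then have "b \<cdot> sinv b \<cdot> (a \<cdot> sinv a) = a \<cdot> sinv a"
      "a \<cdot> sinv a \<cdot> (b \<cdot> sinv b) = b \<cdot> sinv b"
      using ab by (simp_all add: ideal)
    then show ?thesis
      using idem_commute[OF mult_sinv_idem mult_sinv_idem, OF ab] by metis
  qed
  then show ?thesis
    unfolding green_R_def by (auto simp: ideal)
qed

text \<open>The mirror image of \<open>green_R_iff\<close>, with the idempotents
  \<open>sinv x \<cdot> x\<close> acting on the right.\<close>

lemma green_L_iff:
  "(a, b) \<in> green_L S \<longleftrightarrow> a \<in> carrier S \<and> b \<in> carrier S \<and> sinv a \<cdot> a = sinv b \<cdot> b"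
proof -
  have ideal: "left_ideal S x = {y \<in> carrier S. y \<cdot> (sinv x \<cdot> x) = y}"
    if x: "x \<in> carrier S" for x
  proof (intro equalityI subsetI)
    fix y assume "y \<in> left_ideal S x"
    then consider "y = x" | s where "s \<in> carrier S" "y = s \<cdot> x"
      by (auto simp: left_ideal_def)
    then show "y \<in> {y \<in> carrier S. y \<cdot> (sinv x \<cdot> x) = y}"
      by cases (use x in \<open>simp_all add: closed mult_assoc mult_sinv_mult\<close>)
  next
    fix y assume "y \<in> {y \<in> carrier S. y \<cdot> (sinv x \<cdot> x) = y}"
    then have "y = y \<cdot> sinv x \<cdot> x" "y \<cdot> sinv x \<in> carrier S"
      using x by (simp_all add: closed mult_assoc)
    then show "y \<in> left_ideal S x"
      unfolding left_ideal_def by blast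
  qed
  have "sinv a \<cdot> a = sinv b \<cdot> b"
    if ab: "a \<in> carrier S" "b \<in> carrier S" and eq: "left_ideal S a = left_ideal S b"
  proof -
    have "sinv x \<cdot> x \<in> left_ideal S x" if "x \<in> carrier S" for x
      using that by (simp add: ideal closed idem_mult sinv_mult_idem)
    then have "sinv a \<cdot> a \<in> left_ideal S b" "sinv b \<cdot> b \<in> left_ideal S a"
      using ab eq by metis+
    then have "sinv a \<cdot> a \<cdot> (sinv b \<cdot> b) = sinv a \<cdot> a"
      "sinv b \<cdot> b \<cdot> (sinv a \<cdot> a) = sinv b \<cdot> b"
      using ab by (simp_all add: ideal)
    then show ?thesis
      using idem_commute[OF sinv_mult_idem sinv_mult_idem, OF ab] by metis
  qed
  then show ?thesis
    unfolding green_L_def by (auto simp: ideal)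
qed

lemma green_D_iff:
  "(a, b) \<in> green_D S \<longleftrightarrow> a \<in> carrier S \<and> b \<in> carrier S \<and>
     (\<exists>c \<in> carrier S. sinv c \<cdot> c = sinv a \<cdot> a \<and> c \<cdot> sinv c = b \<cdot> sinv b)"
  unfolding green_D_def relcomp_unfold by (auto simp: green_L_iff green_R_iff)

lemma sinv_mult_eq_zero_iff: "a \<in> carrier S \<Longrightarrow> sinv a \<cdot> a = \<bbbzero> \<longleftrightarrow> a = \<bbbzero>"
  by (metis mult_sinv_mult zero_right sinv_closed)

lemma mult_sinv_eq_zero_iff: "a \<in> carrier S \<Longrightarrow> a \<cdot> sinv a = \<bbbzero> \<longleftrightarrow> a = \<bbbzero>"
  by (metis mult_assoc mult_sinv_mult zero_left sinv_closed)

text \<open>The class of zero is a singleton because \<open>sinv a \<cdot> a\<close> and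
  \<open>a \<cdot> sinv a\<close> vanish only at zero. Removing it therefore leaves exactly the
  classes of nonzero elements.\<close>

lemma nonzero_D_classes_eq:
  "nonzero_D_classes S = (\<lambda>a. green_D S `` {a}) ` (carrier S - {\<bbbzero>})"
proof -
  have "green_D S `` {\<bbbzero>} = {\<bbbzero>}"
    by (auto simp: green_D_iff zero_closed sinv_mult_eq_zero_iff zero_right sinv_closed
        sinv_idem zero_idem zero_left mult_sinv_eq_zero_iff intro!: bexI[of _ "\<bbbzero>"])
       (metis mult_sinv_eq_zero_iff sinv_mult_eq_zero_iff)
  moreover have "a \<in> green_D S `` {a}" if "a \<in> carrier S" for a
    using that by (auto simp: green_D_iff)
  ultimately show ?thesis
    unfolding nonzero_D_classes_def quotient_def by blast
qed

end


section \<open>Paths\<close>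

lemma path_comp_assoc: "(p \<bullet> q) \<bullet> r = p \<bullet> (q \<bullet> r)"
  by (cases p; cases q; cases r) auto

lemma
  assumes "is_path G p" "is_path G q" "path_dom G p = path_ran G q"
  shows is_path_comp: "is_path G (p \<bullet> q)"
    and path_ran_comp: "path_ran G (p \<bullet> q) = path_ran G p"
    and path_dom_comp: "path_dom G (p \<bullet> q) = path_dom G q"
proof -
  have "tail G ((es @ fs) ! i) = head G ((es @ fs) ! Suc i)"
    if "p = Edge_Path es" "q = Edge_Path fs" "Suc i < length (es @ fs)" for es fs i
  proof -
    have "es \<noteq> []" "fs \<noteq> []" "tail G (last es) = head G (hd fs)"
      using assms that by auto
    consider "Suc i < length es" | "Suc i = length es" | "length es \<le> i"
      by linarith
    then show ?thesis
    proof cases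
      \<comment> \<open>This is the joint between the two lists, the only index at which the
        condition on domain and range is used.\<close>
      case 2
      then have "es ! i = last es" "fs ! 0 = hd fs"
        using \<open>es \<noteq> []\<close> \<open>fs \<noteq> []\<close> by (metis diff_Suc_1 last_conv_nth, simp add: hd_conv_nth)
      then show ?thesis
        using 2 \<open>tail G (last es) = _\<close> by (simp add: nth_append)
    qed (use assms that in \<open>auto simp: nth_append Suc_diff_le\<close>)
  qed
  then show "is_path G (p \<bullet> q)"
    using assms by (cases p; cases q) auto
  show "path_ran G (p \<bullet> q) = path_ran G p"
    using assms by (cases p; cases q) auto
  show "path_dom G (p \<bullet> q) = path_dom G q"
    using assms by (cases p; cases q) auto
qed

lemma path_comp_right_id: "path_dom G p = v \<Longrightarrow> p \<bullet> Empty_Path v = p"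
  by (cases p) auto

text \<open>Composing an edge path with an empty path forgets the vertex of the latter; the
  hypotheses on ranges restore it.\<close>

lemma path_comp_left_cancel:
  assumes "is_path G p" "is_path G q" "is_path G r" "path_dom G p = path_ran G q"
    "path_dom G p = path_ran G r" "p \<bullet> q = p \<bullet> r"
  shows "q = r"
  using assms by (cases p; cases q; cases r) auto

lemma is_path_Cons:
  assumes "is_path G (Edge_Path (e # es))" "es \<noteq> []"
  shows "is_path G (Edge_Path es)" "e \<in> arcs G" "tail G e = head G (hd es)"
proof -
  have *: "tail G ((e # es) ! i) = head G ((e # es) ! Suc i)" if "Suc i < length (e # es)" for i
    using assms that by auto
  show "tail G e = head G (hd es)"
    using *[of 0] assms(2) by (simp add: hd_conv_nth)
  show "is_path G (Edge_Path es)" "e \<in> arcs G"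
    using assms *[of "Suc _"] by auto
qed

lemma is_path_append:
  assumes "is_path G (Edge_Path (es @ fs))" "es \<noteq> []" "fs \<noteq> []"
  shows "is_path G (Edge_Path fs) \<and> tail G (last es) = head G (hd fs)"
  using assms(2,1)
proof (induction es rule: list_nonempty_induct)
  case (single e)
  then show ?case
    using is_path_Cons[of G e fs] assms(3) by simp
next
  case (cons e es)
  then show ?case
    using is_path_Cons[of G e "es @ fs"] by simp
qed

section \<open>Prefixes and residuals of a path\<close>

lemma prefix_of_edge_path:
  assumes "is_path G q" "path_dom G p = path_ran G q" "p \<bullet> q = Edge_Path es"
  shows "p = Empty_Path (head G (hd es)) \<or> (\<exists>n. p = Edge_Path (take n es))"
proof (cases p)
  case (Edge_Path fs)
  then show ?thesis
    using assms by (cases q) (auto intro: exI[of _ "length fs"])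
qed (use assms in \<open>cases q; auto\<close>)

text \<open>A prefix of an edge path is the empty path at its range or an initial segment of its
  list. This is the source of (P2) for graph inverse semigroups.\<close>

lemma finite_prefixes: "finite {p. \<exists>q. is_residual G r p q}"
proof (cases r)
  case (Empty_Path v)
  have "p = Empty_Path v" if "is_residual G r p q" for p q
    using that Empty_Path by (cases p; cases q) (auto simp: is_residual_def)
  then show ?thesis
    by (auto intro: finite_subset[of _ "{Empty_Path v}"])
next
  case (Edge_Path es)
  have "{p. \<exists>q. is_residual G r p q} \<subseteq>
      insert (Empty_Path (head G (hd es))) ((\<lambda>n. Edge_Path (take n es)) ` {..length es})"
  proof (clarify)
    fix p q assume "is_residual G r p q" and notin: "p \<notin> (\<lambda>n. Edge_Path (take n es)) ` {..length es}"
    then consider "p = Empty_Path (head G (hd es))" | n where "p = Edge_Path (take n es)"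
      using prefix_of_edge_path[of G q p es] Edge_Path by (auto simp: is_residual_def)
    then show "p = Empty_Path (head G (hd es))"
    proof cases
      case 2
      \<comment> \<open>Capping \<open>n\<close> at the length of \<open>es\<close> brings it into
        the finite index set.\<close>
      then have "p = Edge_Path (take (min n (length es)) es)"
        by (simp add: min_def)
      then show ?thesis
        using notin by (metis atMost_iff imageI min.cobounded2)
    qed
  qed
  then show ?thesis
    by (rule finite_subset) simp
qed

lemma is_residual_unique:
  "\<lbrakk>is_path G p; is_residual G r p q; is_residual G r p q'\<rbrakk> \<Longrightarrow> q = q'"
  unfolding is_residual_def by (metis path_comp_left_cancel)

lemma the_residual: "is_path G p \<Longrightarrow> is_residual G r p q \<Longrightarrow> (THE q. is_residual G r p q) = q"
  by (rule the_equality) (auto intro: is_residual_unique)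

section \<open>Induction along paths and comparability of prefixes\<close>

context wf_digraph
begin

lemma path_induct [consumes 1, case_names empty edge]:
  assumes "is_path G p"
    and empty: "\<And>v. v \<in> verts G \<Longrightarrow> P (Empty_Path v)"
    and edge: "\<And>e p. \<lbrakk>e \<in> arcs G; is_path G p; tail G e = path_ran G p; P p\<rbrakk>
      \<Longrightarrow> P (Edge_Path [e] \<bullet> p)"
  shows "P p"
proof (cases p)
  case (Edge_Path es)
  have "P (Edge_Path es)" if "is_path G (Edge_Path es)" "es \<noteq> []" for es
    using that(2,1)
  proof (induction es rule: list_nonempty_induct)
    \<comment> \<open>A single edge is that edge followed by the empty path at its domain, so that
      the base of every induction is an empty path.\<close>
    case (single e)
    then show ?case
      using edge[of e "Empty_Path (tail G e)"] empty by simp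
  next
    case (cons e es)
    then show ?case
      using edge[of e "Edge_Path es"] is_path_Cons[of G e es] by simp
  qed
  then show ?thesis
    using assms(1) Edge_Path by simp
qed (use assms in auto)

lemma path_cases [consumes 1, case_names empty edge]:
  assumes "is_path G p"
  obtains v where "v \<in> verts G" "p = Empty_Path v"
    | e q where "e \<in> arcs G" "is_path G q" "tail G e = path_ran G q" "p = Edge_Path [e] \<bullet> q"
  using assms that by (induction p rule: path_induct) blast+

lemma path_ends: "is_path G p \<Longrightarrow> path_dom G p \<in> verts G \<and> path_ran G p \<in> verts G"
  by (induction p rule: path_induct) (auto simp: path_ran_comp path_dom_comp)

lemma residual_of_ran:
  assumes "is_path G p"
  shows "is_residual G p (Empty_Path (path_ran G p)) p"
  using assms by (simp add: is_residual_def)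

lemma residual_self:
  assumes "is_path G p"
  shows "is_residual G p p (Empty_Path (path_dom G p))"
  using assms path_ends by (simp add: is_residual_def path_comp_right_id)

text \<open>Two initial segments of one list are comparable, and an empty prefix sits at the common
  range. This is the source of (P1) for graph inverse semigroups.\<close>

lemma prefixes_comparable:
  assumes "is_path G p" "is_path G p'" "is_residual G r p q" "is_residual G r p' q'"
  shows "(\<exists>z. is_residual G p p' z) \<or> (\<exists>z. is_residual G p' p z)"
proof -
  have *: "\<exists>z. is_residual G (Edge_Path (es @ us)) (Edge_Path es) z"
    if "is_path G (Edge_Path (es @ us))" "es \<noteq> []" for es us
  proof (cases "us = []")
    case True
    then show ?thesis
      using residual_self[OF that(1)] by auto
  next
    case False
    then show ?thesis
      using is_path_append[of G es us] that
      by (auto simp: is_residual_def intro!: exI[of _ "Edge_Path us"])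
  qed
  have ran: "path_ran G p = path_ran G p'"
    using path_ran_comp[of G p q] path_ran_comp[of G p' q'] assms
    by (simp add: is_residual_def)
  have r: "r = p \<bullet> q" "r = p' \<bullet> q'"
    using assms by (auto simp: is_residual_def)
  show ?thesis
  proof (cases p)
    case (Empty_Path v)
    then show ?thesis
      using residual_of_ran[OF assms(2)] ran by auto
  next
    case (Edge_Path es)
    show ?thesis
    proof (cases p')
      case (Empty_Path v)
      then show ?thesis
        using residual_of_ran[OF assms(1)] ran by auto
    next
      case (Edge_Path es')
      obtain fs where "r = Edge_Path (es @ fs)"
        using r(1) \<open>p = Edge_Path es\<close> by (cases q) auto
      moreover obtain fs' where "r = Edge_Path (es' @ fs')"
        using r(2) Edge_Path by (cases q') auto
      ultimately have "es @ fs = es' @ fs'"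
        by simp
      then obtain us where "es = es' @ us \<or> es @ us = es'"
        by (auto simp: append_eq_append_conv2)
      then show ?thesis
        using *[of es us] *[of es' us] assms(1,2) \<open>p = Edge_Path es\<close> Edge_Path by auto
    qed
  qed
qed

end


section \<open>Semigroups isomorphic to a graph inverse semigroup\<close>

lemma graph_inverse_semigroup_simps:
  "carrier (graph_inverse_semigroup G) = insert Zero
     {Frac x y | x y. is_path G x \<and> is_path G y \<and> path_dom G x = path_dom G y}"
  "sg_mult (graph_inverse_semigroup G) = gis_mult G"
  by (simp_all add: graph_inverse_semigroup_def)

lemma gis_mult_Zero_right: "gis_mult G a Zero = Zero"
  by (cases a) auto

text \<open>The computations take place in \<open>S\<close>, whose inverse semigroup axioms are
  given, and are transported along \<open>h\<close>. In this way associativity and inverses never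
  have to be checked for fractions of paths.\<close>

locale gis_isomorphism = inverse_semigroup_zero S + wf_digraph G
  for S :: "('a, 'b) semigroup_zero_scheme" (structure) and G :: "('v, 'e) pre_digraph" +
  fixes h :: "'a \<Rightarrow> ('v, 'e) gis"
  assumes bij: "bij_betw h (carrier S) (carrier (graph_inverse_semigroup G))"
    and hom: "\<lbrakk>a \<in> carrier S; b \<in> carrier S\<rbrakk> \<Longrightarrow> h (a \<cdot> b) = gis_mult G (h a) (h b)"
begin

definition quot :: "('v, 'e) path \<Rightarrow> ('v, 'e) path \<Rightarrow> 'a" where
  "quot x y = inv_into (carrier S) h (Frac x y)"

definition same_dom :: "('v, 'e) path \<Rightarrow> ('v, 'e) path \<Rightarrow> bool" where
  "same_dom x y \<longleftrightarrow> is_path G x \<and> is_path G y \<and> path_dom G x = path_dom G y"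

lemma same_dom_refl: "is_path G x \<Longrightarrow> same_dom x x"
  by (simp add: same_dom_def)

lemma
  assumes "same_dom x y"
  shows quot_closed: "quot x y \<in> carrier S" and h_quot: "h (quot x y) = Frac x y"
proof -
  have "Frac x y \<in> h ` carrier S"
    using assms bij by (auto simp: bij_betw_def graph_inverse_semigroup_simps same_dom_def)
  then show "quot x y \<in> carrier S" "h (quot x y) = Frac x y"
    unfolding quot_def by (auto intro: inv_into_into f_inv_into_f)
qed

lemma h_eqD: "\<lbrakk>h a = h b; a \<in> carrier S; b \<in> carrier S\<rbrakk> \<Longrightarrow> a = b"
  using bij by (auto simp: bij_betw_def dest: inj_onD)

text \<open>Let \<open>z\<close> be the preimage of \<open>Zero\<close>. Then
  \<open>\<bbbzero> \<cdot> z\<close> is the zero of \<open>S\<close>, while its image is a product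
  with \<open>Zero\<close>.\<close>

lemma h_zero: "h \<bbbzero> = Zero"
proof -
  have "Zero \<in> h ` carrier S"
    using bij by (auto simp: bij_betw_def graph_inverse_semigroup_simps)
  then obtain z where "z \<in> carrier S" "h z = Zero"
    by auto
  then show ?thesis
    using hom[of "\<bbbzero>" z] by (simp add: zero_closed zero_left gis_mult_Zero_right)
qed

lemma nonzero_cases:
  assumes "a \<in> carrier S" "a \<noteq> \<bbbzero>"
  obtains x y where "same_dom x y" "a = quot x y"
proof -
  have "h a \<noteq> Zero"
    using assms h_zero h_eqD zero_closed by metis
  moreover have "h a \<in> carrier (graph_inverse_semigroup G)"
    using bij assms by (auto simp: bij_betw_def)
  ultimately obtain x y where "h a = Frac x y" "same_dom x y"
    by (auto simp: graph_inverse_semigroup_simps same_dom_def)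
  then show ?thesis
    using that h_eqD[of a "quot x y"] assms quot_closed h_quot by metis
qed

lemma quot_eq_iff:
  "same_dom x y \<Longrightarrow> same_dom u v \<Longrightarrow> quot x y = quot u v \<longleftrightarrow> x = u \<and> y = v"
  by (metis h_quot gis.inject)

lemma quot_neq_zero: "same_dom x y \<Longrightarrow> quot x y \<noteq> \<bbbzero>"
  by (metis h_quot h_zero gis.distinct(1))

lemma quot_mult_residual:
  assumes "same_dom x y" "same_dom u v" "is_residual G u y z"
  shows "quot x y \<cdot> quot u v = quot (x \<bullet> z) v"
proof (rule h_eqD)
  have "same_dom (x \<bullet> z) v"
    using assms is_path_comp[of G x z] path_dom_comp[of G x z] path_dom_comp[of G y z]
    by (auto simp: same_dom_def is_residual_def)
  moreover have "(THE z. is_residual G u y z) = z" "\<exists>z. is_residual G u y z"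
    using assms the_residual[of G y u z] by (auto simp: same_dom_def)
  ultimately show "h (quot x y \<cdot> quot u v) = h (quot (x \<bullet> z) v)" "quot (x \<bullet> z) v \<in> carrier S"
    using assms by (simp_all add: hom quot_closed h_quot)
qed (use assms in \<open>simp add: closed quot_closed\<close>)

lemma quot_mult_nonzero:
  assumes "same_dom x y" "same_dom u v" "quot x y \<cdot> quot u v \<noteq> \<bbbzero>"
    and "\<nexists>z. is_residual G u y z"
  shows "\<exists>z. is_residual G y u z \<and> h (quot x y \<cdot> quot u v) = Frac x (v \<bullet> z)"
proof -
  have "h (quot x y \<cdot> quot u v) \<noteq> Zero"
    using assms h_eqD[of _ "\<bbbzero>"] h_zero zero_closed by (metis quot_closed mult_closed)
  then have "gis_mult G (Frac x y) (Frac u v) \<noteq> Zero"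
    using assms by (simp add: hom quot_closed h_quot)
  then obtain z where z: "is_residual G y u z"
    using assms by (auto split: if_splits)
  then show ?thesis
    using assms the_residual[of G u y z]
    by (auto simp: hom quot_closed h_quot same_dom_def)
qed

lemma quot_mult_quot:
  assumes "same_dom x y" "same_dom y v"
  shows "quot x y \<cdot> quot y v = quot x v"
  using assms quot_mult_residual[OF assms residual_self] path_comp_right_id[of G x "path_dom G y"]
  by (simp add: same_dom_def)

lemma same_dom_sym: "same_dom x y \<Longrightarrow> same_dom y x"
  by (simp add: same_dom_def)

lemma same_dom_trans: "same_dom x y \<Longrightarrow> same_dom y z \<Longrightarrow> same_dom x z"
  by (simp add: same_dom_def)

lemma sinv_quot:
  assumes "same_dom x y"
  shows "sinv (quot x y) = quot y x"
  using same_dom_sym[OF assms] same_dom_trans[OF assms] same_dom_trans[of y x] assms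
  by (intro sinv_eqI) (simp_all add: quot_closed quot_mult_quot)

lemma
  assumes "same_dom x y"
  shows quot_mult_sinv: "quot x y \<cdot> sinv (quot x y) = quot x x"
    and sinv_mult_quot: "sinv (quot x y) \<cdot> quot x y = quot y y"
  using assms same_dom_sym[OF assms] by (simp_all add: sinv_quot quot_mult_quot)

section \<open>Idempotents of the graph inverse semigroup and their order\<close>

lemma quot_idem: "is_path G x \<Longrightarrow> quot x x \<in> idempotents S"
  by (simp add: same_dom_refl quot_closed quot_mult_quot idempotentsI)

text \<open>An idempotent is its own inverse, and inversion swaps the two paths of a
  fraction.\<close>

lemma idem_cases:
  assumes "e \<in> idempotents S" "e \<noteq> \<bbbzero>"
  obtains x where "is_path G x" "e = quot x x"
proof -
  obtain x y where xy: "same_dom x y" "e = quot x y"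
    using assms idem_closed nonzero_cases by metis
  then have "quot x y = quot y x"
    using assms(1) sinv_idem sinv_quot by metis
  with quot_eq_iff[OF xy(1) same_dom_sym[OF xy(1)]] have "x = y"
    by blast
  then show ?thesis
    using that[of x] xy by (simp add: same_dom_def)
qed

lemma natural_le_quot_iff:
  assumes "is_path G x" "is_path G y"
  shows "natural_le S (quot x x) (quot y y) \<longleftrightarrow> (\<exists>z. is_residual G x y z)"
proof -
  note c = assms[THEN same_dom_refl]
  have "quot y y \<cdot> quot x x = quot x x" if "is_residual G x y z" for z
    using quot_mult_residual[OF c(2,1) that] that by (simp add: is_residual_def)
  moreover have "\<exists>z. is_residual G x y z" if eq: "quot y y \<cdot> quot x x = quot x x"
  \<comment> \<open>Without a residual the product falls into the second case of the multiplication,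
    where its first path is \<open>y\<close>. It is also \<open>quot x x\<close>, so
    \<open>x = y\<close>, and then the empty path is a residual after all.\<close>
  proof (rule ccontr)
    assume none: "\<nexists>z. is_residual G x y z"
    then have "x = y"
      using quot_mult_nonzero[OF c(2,1) _ none] eq quot_neq_zero[OF c(1)] h_quot[OF c(1)] by auto
    then show False
      using none residual_self assms by blast
  qed
  ultimately show ?thesis
    using assms by (auto simp: natural_le_idem_iff quot_idem)
qed

lemma natural_le_zero_right:
  assumes "e \<in> idempotents S" "natural_le S e \<bbbzero>"
  shows "e = \<bbbzero>"
  using assms by (auto simp: natural_le_idem_iff zero_idem zero_left idem_closed)

lemma residual_empty_iff:
  "is_path G x \<Longrightarrow> (\<exists>z. is_residual G x (Empty_Path v) z) \<longleftrightarrow> v = path_ran G x"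
  by (auto simp: is_residual_def)

lemma residual_of_empty: "is_residual G (Empty_Path v) x z \<Longrightarrow> x = Empty_Path v"
  by (cases x; cases z) (auto simp: is_residual_def)

text \<open>Every path has the empty path at its range as a prefix, and an empty path has only
  itself as a prefix.\<close>

lemma maximal_quot_iff:
  assumes "is_path G x"
  shows "maximal_idempotent S (quot x x) \<longleftrightarrow> (\<exists>v. x = Empty_Path v)"
proof
  let ?r = "Empty_Path (path_ran G x)"
  have r: "is_path G ?r"
    using assms path_ends by simp
  assume "maximal_idempotent S (quot x x)"
  moreover have "natural_le S (quot x x) (quot ?r ?r)"
    using assms r residual_of_ran by (auto simp: natural_le_quot_iff)
  ultimately have "quot ?r ?r = quot x x"
    using quot_idem[OF r] by (auto simp: maximal_idempotent_def)
  then have "x = ?r"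
    using assms r by (simp add: quot_eq_iff same_dom_refl)
  then show "\<exists>v. x = Empty_Path v" ..
next
  assume "\<exists>v. x = Empty_Path v"
  then obtain v where v: "x = Empty_Path v" by auto
  have "f = quot x x" if f: "f \<in> idempotents S" "natural_le S (quot x x) f" for f
  proof (cases "f = \<bbbzero>")
    case True
    then show ?thesis
      using f natural_le_zero_right quot_idem assms by metis
  next
    case False
    then obtain y where "is_path G y" "f = quot y y"
      using f idem_cases by metis
    then show ?thesis
      using f assms v residual_of_empty by (auto simp: natural_le_quot_iff)
  qed
  then show "maximal_idempotent S (quot x x)"
    using assms by (auto simp: maximal_idempotent_def quot_idem)
qed

lemma maximal_cases:
  assumes "maximal_idempotent S m" "natural_le S e m" "e \<in> idempotents S" "e \<noteq> \<bbbzero>"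
  obtains v where "v \<in> verts G" "m = quot (Empty_Path v) (Empty_Path v)"
proof -
  have "m \<in> idempotents S"
    using assms by (simp add: maximal_idempotent_def)
  moreover from this have "m \<noteq> \<bbbzero>"
    using assms natural_le_zero_right by metis
  ultimately obtain x where "is_path G x" "m = quot x x"
    using idem_cases by metis
  then show ?thesis
    using assms(1) that by (auto simp: maximal_quot_iff)
qed

text \<open>An element linking the two has the form \<open>quot z y\<close>, and this fraction
  exists exactly when the domains match.\<close>

lemma green_D_quot_iff:
  assumes "same_dom x y" "is_path G z"
  shows "(quot x y, quot z z) \<in> green_D S \<longleftrightarrow> path_dom G x = path_dom G z"
proof
  assume "(quot x y, quot z z) \<in> green_D S"
  then obtain c where c: "c \<in> carrier S" "sinv c \<cdot> c = quot y y" "c \<cdot> sinv c = quot z z"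
    using assms by (auto simp: green_D_iff sinv_mult_quot quot_mult_sinv same_dom_refl)
  have cy: "same_dom y y"
    using assms by (simp add: same_dom_def)
  have "c \<noteq> \<bbbzero>"
    using c quot_neq_zero[OF cy] sinv_mult_eq_zero_iff by metis
  then obtain u v where uv: "same_dom u v" "c = quot u v"
    using c nonzero_cases by metis
  then have "v = y" "u = z"
    using c cy same_dom_refl[OF assms(2)]
    by (auto simp: sinv_mult_quot quot_mult_sinv quot_eq_iff same_dom_def)
  then show "path_dom G x = path_dom G z"
    using uv assms by (simp add: same_dom_def)
next
  assume "path_dom G x = path_dom G z"
  then have zy: "same_dom z y"
    using assms by (simp add: same_dom_def)
  show "(quot x y, quot z z) \<in> green_D S"
    unfolding green_D_iff
    using assms zy same_dom_refl[OF assms(2)]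
    by (auto simp: quot_closed sinv_mult_quot quot_mult_sinv intro!: bexI[of _ "quot z y"])
qed

section \<open>Verification of combinatoriality and of the Perrot axioms\<close>

lemma combinatorial: "combinatorial S"
proof -
  have "a = b" if "(a, b) \<in> green_H S" for a b
  proof -
    have ab: "a \<in> carrier S" "b \<in> carrier S" "sinv a \<cdot> a = sinv b \<cdot> b" "a \<cdot> sinv a = b \<cdot> sinv b"
      using that by (auto simp: green_H_def green_L_iff green_R_iff)
    show ?thesis
    proof (cases "a = \<bbbzero> \<or> b = \<bbbzero>")
      case True
      then show ?thesis
        using ab sinv_mult_eq_zero_iff by metis
    next
      case False
      then obtain x y u v where "same_dom x y" "a = quot x y" "same_dom u v" "b = quot u v"
        using ab nonzero_cases by metis
      moreover from this have "quot y y = quot v v" "quot x x = quot u u"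
        using ab by (simp_all add: sinv_mult_quot quot_mult_sinv)
      ultimately show ?thesis
        by (auto simp: quot_eq_iff same_dom_def)
    qed
  qed
  moreover have "a \<in> carrier S" if "(a, b) \<in> green_H S" for a b
    using that by (simp add: green_H_def green_L_iff)
  ultimately have "green_H S \<subseteq> Id_on (carrier S)"
    by (metis Id_onI subrelI)
  moreover have "Id_on (carrier S) \<subseteq> green_H S"
    by (auto simp: green_H_def green_L_iff green_R_iff)
  ultimately show ?thesis
    by (simp add: combinatorial_def)
qed

text \<open>The maximal idempotent is the empty path at the common domain of the fractions in the
  class. The result provides both (P4) and properness.\<close>

lemma unique_maximal_in_D_class:
  assumes "C \<in> nonzero_D_classes S"
  shows "\<exists>!m. m \<in> C \<and> maximal_idempotent S m"
proof -
  obtain a where a: "a \<in> carrier S" "a \<noteq> \<bbbzero>" "C = green_D S `` {a}"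
    using assms by (auto simp: nonzero_D_classes_eq)
  then obtain x y where xy: "same_dom x y" "a = quot x y"
    using nonzero_cases by metis
  let ?v = "Empty_Path (path_dom G x)"
  have v: "is_path G ?v"
    using xy path_ends by (simp add: same_dom_def)
  have "m = quot ?v ?v" if m: "m \<in> C" "maximal_idempotent S m" for m
  proof -
    have am: "(a, m) \<in> green_D S"
      using m a by auto
    have "m \<noteq> \<bbbzero>"
      using am a unfolding green_D_iff by (metis mult_sinv_eq_zero_iff sinv_mult_eq_zero_iff)
    then obtain z where z: "is_path G z" "m = quot z z"
      using m idem_cases by (auto simp: maximal_idempotent_def)
    then show ?thesis
      using am m xy by (auto simp: green_D_quot_iff maximal_quot_iff)
  qed
  moreover have "quot ?v ?v \<in> C" "maximal_idempotent S (quot ?v ?v)"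
    using a xy v by (auto simp: green_D_quot_iff maximal_quot_iff)
  ultimately show ?thesis
    by blast
qed

lemma proper_perrot: "proper_perrot_semigroup S"
proof unfold_locales
  show "unambiguous (idempotents S) (natural_le S) \<bbbzero>"
    unfolding unambiguous_def
  proof (intro ballI impI, elim bexE conjE)
    fix e f g
    assume *: "e \<in> idempotents S" "f \<in> idempotents S" "g \<in> idempotents S" "g \<noteq> \<bbbzero>"
      "natural_le S g e" "natural_le S g f"
    then have "e \<noteq> \<bbbzero>" "f \<noteq> \<bbbzero>"
      using natural_le_zero_right by metis+
    then obtain x y z where "is_path G x" "e = quot x x" "is_path G y" "f = quot y y"
      "is_path G z" "g = quot z z"
      using * idem_cases by metis
    then show "natural_le S e f \<or> natural_le S f e"
      using * prefixes_comparable[of x y z] by (auto simp: natural_le_quot_iff)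
  qed
next
  fix e assume e: "e \<in> idempotents S" "e \<noteq> \<bbbzero>"
  then obtain x where x: "is_path G x" "e = quot x x"
    using idem_cases by metis
  have "{f \<in> idempotents S. natural_le S e f} \<subseteq> (\<lambda>y. quot y y) ` {y. \<exists>z. is_residual G x y z}"
  proof clarify
    fix f assume f: "f \<in> idempotents S" "natural_le S e f"
    then have "f \<noteq> \<bbbzero>"
      using e natural_le_zero_right by metis
    then obtain y where "is_path G y" "f = quot y y"
      using f idem_cases by metis
    then show "f \<in> (\<lambda>y. quot y y) ` {y. \<exists>z. is_residual G x y z}"
      using f x by (auto simp: natural_le_quot_iff)
  qed
  then show "finite {f \<in> idempotents S. natural_le S e f}"
    by (rule finite_subset) (simp add: finite_prefixes)
  \<comment> \<open>For (P3), the empty path at the range of \<open>x\<close> is the only empty path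
    that is a prefix of \<open>x\<close>.\<close>
  let ?v = "Empty_Path (path_ran G x)"
  have v: "is_path G ?v"
    using x path_ends by simp
  show "\<exists>!m. maximal_idempotent S m \<and> natural_le S e m"
  proof (rule ex1I[of _ "quot ?v ?v"])
    show "maximal_idempotent S (quot ?v ?v) \<and> natural_le S e (quot ?v ?v)"
      using x v residual_of_ran by (auto simp: maximal_quot_iff natural_le_quot_iff)
  next
    fix m assume m: "maximal_idempotent S m \<and> natural_le S e m"
    then obtain v where "v \<in> verts G" "m = quot (Empty_Path v) (Empty_Path v)"
      using e maximal_cases by metis
    then show "m = quot ?v ?v"
      using m x residual_empty_iff[of x v] by (auto simp: natural_le_quot_iff)
  qed
qed (use unique_maximal_in_D_class in blast)+

end


section \<open>The graph of a combinatorial proper Perrot semigroup\<close>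

text \<open>Needed to invert \<open>gis_val\<close> on a product of fractions; the auxiliary fact
  serves both nonzero cases of the multiplication, with the roles of the paths exchanged.\<close>

lemma gis_mult_closed:
  assumes "a \<in> carrier (graph_inverse_semigroup G)" "b \<in> carrier (graph_inverse_semigroup G)"
  shows "gis_mult G a b \<in> carrier (graph_inverse_semigroup G)"
proof -
  have *: "is_path G (x \<bullet> z) \<and> path_dom G (x \<bullet> z) = path_dom G u"
    if "is_path G x" "is_path G y" "path_dom G x = path_dom G y" "is_residual G u y z" for x y u z
    using that is_path_comp[of G x z] path_dom_comp[of G x z] path_dom_comp[of G y z]
    by (simp add: is_residual_def)
  show ?thesis
  proof (cases "gis_mult G a b = Zero")
    case False
    then obtain x y u v where ab: "a = Frac x y" "b = Frac u v"
      by (metis gis_mult.simps(2) gis_mult_Zero_right gis.exhaust)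
    then have p: "is_path G x" "is_path G y" "path_dom G x = path_dom G y"
        "is_path G u" "is_path G v" "path_dom G u = path_dom G v"
      using assms by (auto simp: graph_inverse_semigroup_simps)
    show ?thesis
    proof (cases "\<exists>z. is_residual G u y z")
      case True
      then obtain z where "is_residual G u y z" ..
      then show ?thesis
        using p ab True *[of x y u z] the_residual[of G y u z]
        by (auto simp: graph_inverse_semigroup_simps)
    next
      case none: False
      then obtain z where "is_residual G y u z"
        using False ab by (auto split: if_splits)
      then show ?thesis
        using p ab none *[of v u y z] the_residual[of G u y z]
        by (auto simp: graph_inverse_semigroup_simps)
    qed
  qed (simp add: graph_inverse_semigroup_simps)
qed

locale combinatorial_proper_perrot = proper_perrot_semigroup +
  assumes comb: "combinatorial S"
begin

section \<open>The axioms in equational form\<close>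

lemma green_H_eqI:
  "\<lbrakk>a \<in> carrier S; b \<in> carrier S; a \<cdot> sinv a = b \<cdot> sinv b; sinv a \<cdot> a = sinv b \<cdot> b\<rbrakk> \<Longrightarrow> a = b"
  using comb unfolding combinatorial_def green_H_def
  by (metis IntI Id_onE green_L_iff green_R_iff prod.inject)

lemma comparable:
  assumes "e \<in> idempotents S" "f \<in> idempotents S" "g \<in> idempotents S" "g \<noteq> \<bbbzero>"
    "e \<cdot> g = g" "f \<cdot> g = g"
  shows "e \<cdot> f = f \<or> f \<cdot> e = e"
  using P1 assms unfolding unambiguous_def by (metis natural_le_idem_iff)

lemma maximal_idem: "maximal_idempotent S e \<Longrightarrow> e \<in> idempotents S"
  by (simp add: maximal_idempotent_def)

lemma maximalD:
  "\<lbrakk>maximal_idempotent S e; f \<in> idempotents S; f \<cdot> e = e\<rbrakk> \<Longrightarrow> f = e"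
  by (simp add: maximal_idempotent_def natural_le_idem_iff)

text \<open>By (P1) the two idempotents are comparable, and nothing lies strictly above
  \<open>m\<close>.\<close>

lemma le_maximal:
  assumes "maximal_idempotent S m" "e \<in> idempotents S" "g \<in> idempotents S" "g \<noteq> \<bbbzero>"
    "m \<cdot> g = g" "e \<cdot> g = g"
  shows "m \<cdot> e = e"
  using assms comparable[of m e g] maximalD maximal_idem idem_mult by metis

definition roof :: "'a \<Rightarrow> 'a" where
  "roof e = (THE m. maximal_idempotent S m \<and> natural_le S e m)"

lemma
  assumes "e \<in> idempotents S" "e \<noteq> \<bbbzero>"
  shows roof_maximal: "maximal_idempotent S (roof e)" and roof_mult: "roof e \<cdot> e = e"
  using theI'[OF P3[OF assms]] assms maximal_idem
  by (auto simp: roof_def[symmetric] natural_le_idem_iff)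

lemma roof_eqI:
  assumes "e \<in> idempotents S" "e \<noteq> \<bbbzero>" "maximal_idempotent S m" "m \<cdot> e = e"
  shows "roof e = m"
  unfolding roof_def
  by (rule the1_equality[OF P3[OF assms(1,2)]])
     (use assms maximal_idem in \<open>simp add: natural_le_idem_iff\<close>)

section \<open>Path elements, their products and quotients\<close>

definition path_elems :: "'a set" where
  "path_elems = {x \<in> carrier S. x \<noteq> \<bbbzero> \<and> maximal_idempotent S (sinv x \<cdot> x)}"

lemma
  assumes "x \<in> path_elems"
  shows path_elem_closed: "x \<in> carrier S"
    and path_elem_nonzero: "x \<noteq> \<bbbzero>"
    and path_elem_maximal: "maximal_idempotent S (sinv x \<cdot> x)"
    and path_elem_ran_idem: "x \<cdot> sinv x \<in> idempotents S"
    and path_elem_ran_nonzero: "x \<cdot> sinv x \<noteq> \<bbbzero>"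
    and path_elem_dom_nonzero: "sinv x \<cdot> x \<noteq> \<bbbzero>"
  using assms
  by (auto simp: path_elems_def mult_sinv_idem mult_sinv_eq_zero_iff sinv_mult_eq_zero_iff)

lemma mult_ran_eq_iff:
  assumes "e \<in> carrier S" "x \<in> carrier S"
  shows "e \<cdot> (x \<cdot> sinv x) = x \<cdot> sinv x \<longleftrightarrow> e \<cdot> x = x"
  using assms by (metis closed mult_assoc mult_sinv_mult)

text \<open>Equal ranges make \<open>sinv y \<cdot> x\<close> a link between the two domain
  idempotents, which therefore lie in one \<open>D\<close>-class. Both are maximal, so properness
  identifies them, and then \<open>x\<close> and \<open>y\<close> are
  \<open>H\<close>-related.\<close>

lemma path_elem_eqI:
  assumes x: "x \<in> path_elems" and y: "y \<in> path_elems" and eq: "x \<cdot> sinv x = y \<cdot> sinv y"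
  shows "x = y"
proof -
  note [simp] = x[THEN path_elem_closed] y[THEN path_elem_closed] closed mult_assoc
  let ?e = "sinv x \<cdot> x" and ?f = "sinv y \<cdot> y" and ?c = "sinv y \<cdot> x"
  have "y \<cdot> (sinv y \<cdot> x) = x \<cdot> sinv x \<cdot> x" "x \<cdot> (sinv x \<cdot> y) = y \<cdot> sinv y \<cdot> y"
    using eq by (simp_all flip: mult_assoc)
  then have "y \<cdot> (sinv y \<cdot> x) = x" "x \<cdot> (sinv x \<cdot> y) = y"
    by (simp_all add: mult_sinv_mult)
  then have "sinv ?c \<cdot> ?c = ?e" "?c \<cdot> sinv ?c = ?f"
    by (simp_all add: sinv_mult)
  note c = this
  have idem: "?e \<in> idempotents S" "?f \<in> idempotents S"
    by (simp_all add: sinv_mult_idem)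
  then have i: "sinv ?e \<cdot> ?e = ?e" "?e \<cdot> sinv ?e = ?e" "?f \<cdot> sinv ?f = ?f"
    by (simp_all only: sinv_idem idem_mult)
  have "(?e, ?f) \<in> green_D S"
    unfolding green_D_iff i by (intro conjI bexI[of _ ?c] c) simp_all
  moreover have "(?e, ?e) \<in> green_D S"
    unfolding green_D_iff i by (intro conjI bexI[of _ ?e] i) simp_all
  ultimately have "?e \<in> green_D S `` {?e}" "?f \<in> green_D S `` {?e}"
    by auto
  moreover have "green_D S `` {?e} \<in> nonzero_D_classes S"
    using path_elem_dom_nonzero[OF x] by (simp add: nonzero_D_classes_eq)
  ultimately have "?e = ?f"
    using proper path_elem_maximal[OF x] path_elem_maximal[OF y] by blast
  then show ?thesis
    using eq by (simp add: green_H_eqI)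
qed

text \<open>By (P4) some maximal idempotent is \<open>D\<close>-related to \<open>e\<close>; the
  inverse of the linking element is the required path element.\<close>

lemma path_elem_exists:
  assumes "e \<in> idempotents S" "e \<noteq> \<bbbzero>"
  obtains x where "x \<in> path_elems" "x \<cdot> sinv x = e"
proof -
  have "green_D S `` {e} \<in> nonzero_D_classes S"
    using assms by (auto simp: nonzero_D_classes_eq idem_closed)
  then obtain m where m: "(e, m) \<in> green_D S" "maximal_idempotent S m"
    using P4 by blast
  then obtain c where c: "c \<in> carrier S" "sinv c \<cdot> c = e" "c \<cdot> sinv c = m"
    using assms by (auto simp: green_D_iff sinv_idem idem_mult maximal_idem)
  then have "sinv c \<noteq> \<bbbzero>"
    using assms zero_left by auto
  then have "sinv c \<in> path_elems"
    using c m by (simp add: path_elems_def closed)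
  then show thesis
    using that c by simp
qed

text \<open>The third hypothesis says that the range idempotent of \<open>y\<close> lies below the
  domain idempotent of \<open>x\<close>, which is composability of paths. It gives the product the
  domain of \<open>y\<close>, which is maximal.\<close>

lemma
  assumes "x \<in> path_elems" "y \<in> path_elems" "sinv x \<cdot> x \<cdot> y = y"
  shows path_elem_mult: "x \<cdot> y \<in> path_elems"
    and path_elem_mult_dom: "sinv (x \<cdot> y) \<cdot> (x \<cdot> y) = sinv y \<cdot> y"
proof -
  note c = assms(1,2)[THEN path_elem_closed]
  show dom: "sinv (x \<cdot> y) \<cdot> (x \<cdot> y) = sinv y \<cdot> y"
    using c assms(3) by (simp add: sinv_mult closed mult_assoc)
  have "x \<cdot> y \<noteq> \<bbbzero>"
    using c dom path_elem_dom_nonzero[OF assms(2)] by (metis closed sinv_mult_eq_zero_iff)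
  then show "x \<cdot> y \<in> path_elems"
    using c dom path_elem_maximal[OF assms(2)] by (simp add: path_elems_def closed)
qed

text \<open>Left division by a prefix. The roof of the quotient's range is the domain of
  \<open>x\<close>, so the quotient will correspond to a path that can follow the one for
  \<open>x\<close>.\<close>

lemma
  assumes "x \<in> path_elems" "y \<in> path_elems" "x \<cdot> sinv x \<cdot> y = y"
  shows path_elem_quotient: "sinv x \<cdot> y \<in> path_elems"
    and path_elem_quotient_mult: "x \<cdot> (sinv x \<cdot> y) = y"
    and path_elem_quotient_ran:
      "roof (sinv x \<cdot> y \<cdot> sinv (sinv x \<cdot> y)) = sinv x \<cdot> x"
proof -
  note c = assms(1,2)[THEN path_elem_closed]
  have dom: "sinv (sinv x \<cdot> y) \<cdot> (sinv x \<cdot> y) = sinv y \<cdot> y"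
    using c assms(3) by (simp add: sinv_mult closed mult_assoc)
  have "sinv x \<cdot> y \<noteq> \<bbbzero>"
    using c dom path_elem_dom_nonzero[OF assms(2)] by (metis closed sinv_mult_eq_zero_iff)
  then show el: "sinv x \<cdot> y \<in> path_elems"
    using c dom path_elem_maximal[OF assms(2)] by (simp add: path_elems_def closed)
  show "x \<cdot> (sinv x \<cdot> y) = y"
    using c assms(3) by (simp add: closed mult_assoc)
  show "roof (sinv x \<cdot> y \<cdot> sinv (sinv x \<cdot> y)) = sinv x \<cdot> x"
    using path_elem_ran_idem[OF el] path_elem_ran_nonzero[OF el] path_elem_maximal[OF assms(1)] c
    by (intro roof_eqI) (simp_all add: closed mult_assoc sinv_mult sinv_mult_sinv_left)
qed

section \<open>Edges and the graph\<close>

text \<open>The first condition rules out the vertices, since a maximal idempotent satisfies the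
  second one trivially.\<close>

definition arc_elems :: "'a set" where
  "arc_elems = {x \<in> path_elems. \<not> maximal_idempotent S (x \<cdot> sinv x) \<and>
     (\<forall>f \<in> idempotents S. f \<cdot> (x \<cdot> sinv x) = x \<cdot> sinv x \<longrightarrow>
        f = x \<cdot> sinv x \<or> maximal_idempotent S f)}"

lemma
  assumes "x \<in> arc_elems"
  shows arc_path_elem: "x \<in> path_elems"
    and arc_not_maximal: "\<not> maximal_idempotent S (x \<cdot> sinv x)"
    and arc_cover: "\<And>f. \<lbrakk>f \<in> idempotents S; f \<cdot> (x \<cdot> sinv x) = x \<cdot> sinv x\<rbrakk>
        \<Longrightarrow> f = x \<cdot> sinv x \<or> maximal_idempotent S f"
  using assms by (auto simp: arc_elems_def)

text \<open>Zero is excluded from the vertices because it is a maximal idempotent of the trivial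
  semigroup, whose graph has to be empty. The range idempotent of an edge is not maximal, hence the
  \<open>roof\<close> in the head.\<close>

definition perrot_graph :: "('a, 'a) pre_digraph" where
  "perrot_graph = \<lparr>verts = {m. maximal_idempotent S m \<and> m \<noteq> \<bbbzero>}, arcs = arc_elems,
     tail = \<lambda>x. sinv x \<cdot> x, head = \<lambda>x. roof (x \<cdot> sinv x)\<rparr>"

lemma perrot_graph_simps [simp]:
  "verts perrot_graph = {m. maximal_idempotent S m \<and> m \<noteq> \<bbbzero>}"
  "arcs perrot_graph = arc_elems"
  "tail perrot_graph x = sinv x \<cdot> x"
  "head perrot_graph x = roof (x \<cdot> sinv x)"
  by (simp_all add: perrot_graph_def)

lemma roof_nonzero: "e \<in> idempotents S \<Longrightarrow> e \<noteq> \<bbbzero> \<Longrightarrow> roof e \<noteq> \<bbbzero>"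
  by (metis roof_mult zero_left idem_closed)

sublocale graph: wf_digraph perrot_graph
  by unfold_locales
     (auto dest!: arc_path_elem simp: path_elem_maximal path_elem_dom_nonzero roof_maximal
       roof_nonzero path_elem_ran_idem path_elem_ran_nonzero)

section \<open>Evaluation of paths in the semigroup\<close>

text \<open>The fold starts at the domain idempotent of the last edge. It acts as the value of the
  empty path there, so prepending an edge is multiplication in every case.\<close>

fun val :: "('a, 'a) path \<Rightarrow> 'a" where
  "val (Empty_Path v) = v"
| "val (Edge_Path es) = foldr (\<cdot>) es (sinv (last es) \<cdot> last es)"

lemma val_edge_comp:
  assumes "is_path perrot_graph p" "tail perrot_graph e = path_ran perrot_graph p"
  shows "val (Edge_Path [e] \<bullet> p) = e \<cdot> val p"
  using assms by (cases p) auto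

text \<open>The three facts are proved in one induction: composability of \<open>e\<close> with
  \<open>val p\<close>, on which the products rest, comes from the range fact for
  \<open>p\<close>.\<close>

lemma
  assumes "is_path perrot_graph p"
  shows val_path_elem: "val p \<in> path_elems"
    and val_dom: "sinv (val p) \<cdot> val p = path_dom perrot_graph p"
    and val_ran: "path_ran perrot_graph p \<cdot> val p = val p"
  using assms
proof (induction p rule: graph.path_induct)
  case (empty v)
  {
    case 1
    then show ?case using empty
      by (auto simp: path_elems_def maximal_idem idem_closed idem_mult sinv_idem)
  next
    case 2
    then show ?case using empty
      by (auto simp: maximal_idem idem_mult sinv_idem)
  next
    case 3
    then show ?case using empty
      by (auto simp: maximal_idem idem_mult)
  }
next
  case (edge e p)
  have e: "e \<in> path_elems"
    using edge by (simp add: arc_path_elem)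
  note c = path_elem_closed[OF e] path_elem_closed[OF edge(4)]
  have le: "sinv e \<cdot> e \<cdot> val p = val p"
    using edge by simp
  have e1: "is_path perrot_graph (Edge_Path [e])"
    "path_dom perrot_graph (Edge_Path [e]) = path_ran perrot_graph p"
    using edge by auto
  have head: "head perrot_graph e \<in> carrier S" "head perrot_graph e \<cdot> e = e"
    using path_elem_ran_idem[OF e] path_elem_ran_nonzero[OF e] c
    by (simp_all add: roof_maximal maximal_idem idem_closed roof_mult flip: mult_ran_eq_iff)
  note v = val_edge_comp[OF edge(2,3)]
  {
    case 1
    then show ?case
      unfolding v using path_elem_mult[OF e edge(4) le] .
  next
    case 2
    then show ?case
      unfolding v using path_elem_mult_dom[OF e edge(4) le] edge path_dom_comp[OF e1(1) edge(2) e1(2)]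
      by simp
  next
    case 3
    then show ?case
      unfolding v using path_ran_comp[OF e1(1) edge(2) e1(2)] head c
      by (simp flip: mult_assoc)
  }
qed

lemma val_comp:
  assumes "is_path perrot_graph p" "is_path perrot_graph q"
    "path_dom perrot_graph p = path_ran perrot_graph q"
  shows "val (p \<bullet> q) = val p \<cdot> val q"
  using assms
proof (induction p rule: graph.path_induct)
  case (empty v)
  then show ?case
    using val_ran[of q] by simp
next
  case (edge e p)
  have e1: "is_path perrot_graph (Edge_Path [e])"
    "path_dom perrot_graph (Edge_Path [e]) = path_ran perrot_graph p"
    using edge by auto
  have pq: "path_dom perrot_graph p = path_ran perrot_graph q"
    using edge path_dom_comp[OF e1(1) edge(2) e1(2)] by simp
  have "val ((Edge_Path [e] \<bullet> p) \<bullet> q) = e \<cdot> val (p \<bullet> q)"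
    unfolding path_comp_assoc
    using edge path_ran_comp[OF edge(2) _ pq] is_path_comp[OF edge(2) _ pq]
    by (intro val_edge_comp) simp_all
  also have "\<dots> = e \<cdot> val p \<cdot> val q"
    using edge pq path_elem_closed val_path_elem arc_path_elem by (simp add: mult_assoc)
  finally show ?case
    using val_edge_comp edge by simp
qed

lemma ran_mult_ran:
  assumes "x \<in> carrier S" "y \<in> carrier S"
  shows "x \<cdot> sinv x \<cdot> (x \<cdot> y \<cdot> sinv (x \<cdot> y)) = x \<cdot> y \<cdot> sinv (x \<cdot> y)"
  using assms by (simp add: closed mult_assoc mult_sinv_mult_left)

text \<open>The range idempotent of a product lies below that of its first factor \<open>e\<close>;
  were it maximal, the two would coincide. This separates empty paths from edge paths by their
  values.\<close>

lemma arc_mult_not_maximal: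
  assumes "e \<in> arc_elems" "y \<in> carrier S"
  shows "\<not> maximal_idempotent S (e \<cdot> y \<cdot> sinv (e \<cdot> y))"
proof
  note e = arc_path_elem[OF assms(1)]
  assume "maximal_idempotent S (e \<cdot> y \<cdot> sinv (e \<cdot> y))"
  then show False
    using maximalD[OF _ path_elem_ran_idem[OF e] ran_mult_ran[OF path_elem_closed[OF e] assms(2)]]
      arc_not_maximal[OF assms(1)] by simp
qed

text \<open>The range idempotents of \<open>e\<close> and \<open>f\<close> both lie above that of
  the nonzero product, so (P1) makes them comparable. Above either of them there are only maximal
  idempotents, and neither is maximal, so they agree.\<close>

lemma arc_eqI:
  assumes arcs: "e \<in> arc_elems" "f \<in> arc_elems" and cl: "y \<in> carrier S" "z \<in> carrier S"
    and eq: "e \<cdot> y = f \<cdot> z" and nz: "e \<cdot> y \<noteq> \<bbbzero>"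
  shows "e = f"
proof (rule path_elem_eqI)
  note e = arc_path_elem[OF arcs(1)] and f = arc_path_elem[OF arcs(2)]
  show "e \<in> path_elems" "f \<in> path_elems" using e f .
  let ?g = "e \<cdot> y \<cdot> sinv (e \<cdot> y)"
  have "?g \<in> idempotents S" "?g \<noteq> \<bbbzero>"
    using cl e nz by (simp_all add: path_elem_closed closed mult_sinv_idem mult_sinv_eq_zero_iff)
  then have "e \<cdot> sinv e \<cdot> (f \<cdot> sinv f) = f \<cdot> sinv f \<or> f \<cdot> sinv f \<cdot> (e \<cdot> sinv e) = e \<cdot> sinv e"
    using comparable[OF path_elem_ran_idem[OF e] path_elem_ran_idem[OF f], of ?g]
      ran_mult_ran[OF path_elem_closed[OF e] cl(1)] ran_mult_ran[OF path_elem_closed[OF f] cl(2)] eq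
    by simp
  then show "e \<cdot> sinv e = f \<cdot> sinv f"
    using arc_cover[OF arcs(1) path_elem_ran_idem[OF f]] arc_cover[OF arcs(2) path_elem_ran_idem[OF e]]
      arc_not_maximal[OF arcs(1)] arc_not_maximal[OF arcs(2)] by auto
qed

text \<open>The first edge is determined by the value through \<open>arc_eqI\<close> and can then be
  cancelled on the left.\<close>

lemma val_inj:
  assumes "is_path perrot_graph p" "is_path perrot_graph q" "val p = val q"
  shows "p = q"
  using assms
proof (induction p arbitrary: q rule: graph.path_induct)
  case (empty v)
  from empty(2) show ?case
  proof (cases rule: graph.path_cases)
    case (edge e p)
    then have "e \<cdot> val p = v"
      using empty val_edge_comp[OF edge(2,3)] by simp
    then have "maximal_idempotent S (e \<cdot> val p \<cdot> sinv (e \<cdot> val p))"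
      using empty by (simp add: sinv_idem maximal_idem idem_mult)
    then show ?thesis
      using edge arc_mult_not_maximal path_elem_closed val_path_elem by simp
  qed (use empty in simp)
next
  case (edge e p)
  note v = val_edge_comp[OF edge(2,3)] and c = path_elem_closed[OF val_path_elem[OF edge(2)]]
  from edge(5) show ?case
  proof (cases rule: graph.path_cases)
    case (empty w)
    then have "e \<cdot> val p = w" "maximal_idempotent S w"
      using edge(6) v by simp_all
    then have "maximal_idempotent S (e \<cdot> val p \<cdot> sinv (e \<cdot> val p))"
      by (simp add: sinv_idem maximal_idem idem_mult)
    then show ?thesis
      using edge(1) arc_mult_not_maximal c by simp
  next
    case r: (edge f r)
    note d = path_elem_closed[OF val_path_elem[OF r(2)]]
    have eq: "e \<cdot> val p = f \<cdot> val r"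
      using edge(6) v val_edge_comp[OF r(2,3)] r(4) by simp
    have arcs: "e \<in> arc_elems" "f \<in> arc_elems"
      using edge(1) r(1) by simp_all
    have le: "sinv e \<cdot> e \<cdot> val p = val p" "sinv f \<cdot> f \<cdot> val r = val r"
      using val_ran[OF edge(2)] val_ran[OF r(2)] edge(3) r(3) by simp_all
    have "e \<cdot> val p \<noteq> \<bbbzero>"
      using path_elem_nonzero[OF path_elem_mult] arc_path_elem[OF arcs(1)] val_path_elem[OF edge(2)]
        le(1) by blast
    then have ef: "e = f"
      using arc_eqI arcs eq c d by blast
    have "sinv e \<cdot> (e \<cdot> val p) = val p" "sinv f \<cdot> (f \<cdot> val r) = val r"
      using le c d arcs[THEN arc_path_elem, THEN path_elem_closed] by (simp_all add: mult_assoc closed)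
    then have "val p = val r"
      using eq unfolding ef by metis
    then show ?thesis
      using edge(4) r ef by simp
  qed
qed

section \<open>Factorisation of path elements into edges\<close>

definition above :: "'a \<Rightarrow> 'a set" where
  "above e = {f \<in> idempotents S. f \<cdot> e = e}"

lemma finite_above: "e \<in> idempotents S \<Longrightarrow> e \<noteq> \<bbbzero> \<Longrightarrow> finite (above e)"
  using P2[of e] by (simp add: above_def natural_le_idem_iff cong: conj_cong)

text \<open>Makes the size of \<open>above\<close> a measure of depth, used to find covers and for
  the induction in \<open>val_surj\<close>.\<close>

lemma above_psubset:
  assumes "e \<in> idempotents S" "f \<in> idempotents S" "f \<cdot> e = e" "f \<noteq> e"
  shows "above f \<subset> above e"
proof -
  have "e \<notin> above f"
    using assms idem_commute[of e f] by (auto simp: above_def)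
  moreover have "g \<cdot> e = e" if "g \<in> idempotents S" "g \<cdot> f = f" for g
    using that assms by (metis mult_assoc idem_closed)
  ultimately show ?thesis
    using assms by (auto simp: above_def idem_mult)
qed

text \<open>Among the finitely many idempotents strictly above \<open>e\<close>, choose
  \<open>f\<close> with the most idempotents above it. Anything strictly between \<open>e\<close>
  and \<open>f\<close> would have still more.\<close>

lemma cover_exists:
  assumes e: "e \<in> idempotents S" "e \<noteq> \<bbbzero>" "\<not> maximal_idempotent S e"
  obtains f where "f \<in> idempotents S" "f \<cdot> e = e" "f \<noteq> e"
    and "\<And>g. \<lbrakk>g \<in> idempotents S; g \<cdot> e = e; f \<cdot> g = g\<rbrakk> \<Longrightarrow> g = e \<or> g = f"
proof -
  let ?U = "above e - {e}"
  let ?K = "(\<lambda>f. card (above f)) ` ?U"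
  have "?U \<noteq> {}"
    using e by (auto simp: maximal_idempotent_def above_def natural_le_idem_iff)
  moreover have fin: "finite ?U"
    using e finite_above by simp
  ultimately have "Max ?K \<in> ?K"
    by (intro Max_in) auto
  then obtain f where f: "Max ?K = card (above f)" "f \<in> ?U"
    by (elim imageE)
  have "g = e \<or> g = f" if g: "g \<in> idempotents S" "g \<cdot> e = e" "f \<cdot> g = g" for g
  proof (rule ccontr)
    assume "\<not> (g = e \<or> g = f)"
    then have "g \<in> ?U" "above f \<subset> above g"
      using g f above_psubset[of g f] by (auto simp: above_def)
    moreover have "g \<noteq> \<bbbzero>"
      using g e by (metis zero_left idem_closed)
    ultimately have "card (above f) < card (above g)" "card (above g) \<le> Max ?K"
      using fin g finite_above by (auto intro: psubset_card_mono Max_ge)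
    then show False
      using f by simp
  qed
  then show thesis
    using that f by (auto simp: above_def)
qed

text \<open>Conjugation by \<open>y\<close> carries the idempotents between the range of
  \<open>sinv y \<cdot> x\<close> and \<open>sinv y \<cdot> y\<close> to those between the ranges of
  \<open>x\<close> and \<open>y\<close>, where by hypothesis only the two ends occur.\<close>

lemma quotient_arc:
  assumes x: "x \<in> path_elems" and y: "y \<in> path_elems"
    and le: "y \<cdot> sinv y \<cdot> (x \<cdot> sinv x) = x \<cdot> sinv x" and ne: "x \<cdot> sinv x \<noteq> y \<cdot> sinv y"
    and cover: "\<And>g. \<lbrakk>g \<in> idempotents S; g \<cdot> (x \<cdot> sinv x) = x \<cdot> sinv x; y \<cdot> sinv y \<cdot> g = g\<rbrakk>
      \<Longrightarrow> g = x \<cdot> sinv x \<or> g = y \<cdot> sinv y"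
  shows "sinv y \<cdot> x \<in> arc_elems"
proof -
  note [simp] = path_elem_closed[OF x] path_elem_closed[OF y] closed
  have yx: "y \<cdot> sinv y \<cdot> x = x"
    using le by (simp add: mult_ran_eq_iff)
  let ?b = "sinv y \<cdot> x"
  have b: "?b \<in> path_elems" and yb: "y \<cdot> ?b = x"
    using path_elem_quotient path_elem_quotient_mult x y yx by blast+
  let ?r = "?b \<cdot> sinv ?b" and ?m = "sinv y \<cdot> y"
  have m: "maximal_idempotent S ?m" "?m \<cdot> ?r = ?r"
    using path_elem_maximal[OF y] by (simp_all add: sinv_mult mult_assoc sinv_mult_sinv_left)
  have yr: "y \<cdot> (?r \<cdot> sinv y) = x \<cdot> sinv x"
  proof -
    have "y \<cdot> (?r \<cdot> sinv y) = (y \<cdot> ?b) \<cdot> sinv (y \<cdot> ?b)"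
      by (simp add: sinv_mult mult_assoc)
    then show ?thesis
      by (simp only: yb)
  qed
  have r: "?r \<in> idempotents S" "?r \<noteq> \<bbbzero>"
    using path_elem_ran_idem[OF b] path_elem_ran_nonzero[OF b] .
  have "\<not> maximal_idempotent S ?r"
  proof
    assume "maximal_idempotent S ?r"
    then have "?m = ?r"
      using m maximalD maximal_idem by metis
    then have "x \<cdot> sinv x = y \<cdot> (?m \<cdot> sinv y)"
      using yr by simp
    then show False
      using ne by (simp add: mult_assoc mult_sinv_mult_left)
  qed
  moreover have "g = ?r \<or> maximal_idempotent S g"
    if g: "g \<in> idempotents S" "g \<cdot> ?r = ?r" for g
  proof -
    note [simp] = idem_closed[OF g(1)]
    \<comment> \<open>This puts \<open>g\<close> below the domain idempotent of \<open>y\<close>, so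
      conjugating by \<open>y\<close> and back loses nothing.\<close>
    have mg: "?m \<cdot> g = g"
      using le_maximal[of ?m g ?r] m r g by simp
    then have gm: "g \<cdot> ?m = g"
      using idem_commute[of g ?m] g by (simp add: sinv_mult_idem)
    let ?k = "y \<cdot> (g \<cdot> sinv y)"
    have "sinv y \<cdot> (?k \<cdot> y) = ?m \<cdot> (g \<cdot> ?m)"
      by (simp add: mult_assoc)
    then have conj: "sinv y \<cdot> (?k \<cdot> y) = g"
      by (simp only: mg gm)
    have "?k \<cdot> x = y \<cdot> (g \<cdot> ?b)"
      by (simp add: mult_assoc)
    also have "g \<cdot> ?b = ?b"
      using g by (simp add: mult_ran_eq_iff)
    finally have "?k \<cdot> (x \<cdot> sinv x) = x \<cdot> sinv x"
      by (simp add: mult_ran_eq_iff yb)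
    moreover have "y \<cdot> sinv y \<cdot> ?k = ?k"
      by (simp add: mult_assoc mult_sinv_mult_left)
    ultimately have "?k = y \<cdot> (?r \<cdot> sinv y) \<or> ?k = y \<cdot> sinv y"
      using cover[of ?k] conj_idem[of y g] g yr by simp
    then show ?thesis
    proof
      assume "?k = y \<cdot> (?r \<cdot> sinv y)"
      then have "g = sinv y \<cdot> ((y \<cdot> (?r \<cdot> sinv y)) \<cdot> y)"
        using conj by simp
      also have "\<dots> = ?r"
        by (simp add: sinv_mult mult_assoc sinv_mult_sinv_left
            mult_sinv_mult)
      finally show ?thesis ..
    next
      assume "?k = y \<cdot> sinv y"
      then have "g = sinv y \<cdot> (y \<cdot> sinv y \<cdot> y)"
        using conj by simp
      then show ?thesis
        using m by (simp add: mult_assoc mult_sinv_mult)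
    qed
  qed
  ultimately show ?thesis
    using b by (simp add: arc_elems_def)
qed

text \<open>Induction on the number of idempotents above the range of \<open>x\<close>. A cover of
  that range is the range of a path element \<open>y\<close>, which evaluates a path by induction,
  and the remaining factor \<open>sinv y \<cdot> x\<close> is a single edge appended at the domain
  end.\<close>

lemma val_surj:
  assumes "x \<in> path_elems"
  shows "\<exists>p. is_path perrot_graph p \<and> val p = x"
  using assms
proof (induction "card (above (x \<cdot> sinv x))" arbitrary: x rule: less_induct)
  case less
  note x = less.prems
  let ?e = "x \<cdot> sinv x"
  note e = path_elem_ran_idem[OF x] path_elem_ran_nonzero[OF x]
  show ?case
  proof (cases "maximal_idempotent S ?e")
    case True
    then have "?e \<in> path_elems"
      using e by (simp add: path_elems_def idem_closed idem_mult sinv_idem)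
    \<comment> \<open>A maximal range idempotent is itself a path element with the same range as
      \<open>x\<close>, so \<open>x\<close> is a vertex.\<close>
    then have "x = ?e"
      using x e by (intro path_elem_eqI[OF x]) (simp_all add: sinv_idem idem_mult)
    then show ?thesis
      using True e by (intro exI[of _ "Empty_Path ?e"]) auto
  next
    case False
    then obtain f where f: "f \<in> idempotents S" "f \<cdot> ?e = ?e" "f \<noteq> ?e"
      and cover: "\<And>g. \<lbrakk>g \<in> idempotents S; g \<cdot> ?e = ?e; f \<cdot> g = g\<rbrakk> \<Longrightarrow> g = ?e \<or> g = f"
      using cover_exists e by metis
    have "f \<noteq> \<bbbzero>"
      using f e by (metis zero_left idem_closed)
    then obtain y where y: "y \<in> path_elems" "y \<cdot> sinv y = f"
      using f path_elem_exists by metis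
    have "card (above f) < card (above ?e)"
      using above_psubset e f finite_above by (intro psubset_card_mono) auto
    then obtain p where p: "is_path perrot_graph p" "val p = y"
      using less.hyps[of y] y by auto
    have yx: "y \<cdot> sinv y \<cdot> x = x"
      using f y path_elem_closed[OF x] idem_closed by (simp add: mult_ran_eq_iff)
    have b: "sinv y \<cdot> x \<in> arc_elems"
      using quotient_arc[OF x y(1)] f y(2) cover by metis
    have q: "is_path perrot_graph (Edge_Path [sinv y \<cdot> x])"
      using b by simp
    have "path_dom perrot_graph p = path_ran perrot_graph (Edge_Path [sinv y \<cdot> x])"
      using val_dom[OF p(1)] p(2) path_elem_quotient_ran[OF y(1) x yx] by simp
    moreover have "val (Edge_Path [sinv y \<cdot> x]) = sinv y \<cdot> x"
      using path_elem_closed[OF arc_path_elem[OF b]] by (simp add: mult_sinv_mult)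
    ultimately have "is_path perrot_graph (p \<bullet> Edge_Path [sinv y \<cdot> x])"
      "val (p \<bullet> Edge_Path [sinv y \<cdot> x]) = y \<cdot> (sinv y \<cdot> x)"
      using is_path_comp[OF p(1) q] val_comp[OF p(1) q] p(2) by simp_all
    then show ?thesis
      using path_elem_quotient_mult[OF y(1) x yx] by metis
  qed
qed

text \<open>The quotient \<open>sinv (val y) \<cdot> val u\<close> is a path element, so it
  evaluates some path \<open>z\<close>; injectivity of \<open>val\<close> turns the equation of
  values into \<open>u = y \<bullet> z\<close>.\<close>

lemma residual_if_le:
  assumes y: "is_path perrot_graph y" and u: "is_path perrot_graph u"
    and le: "val y \<cdot> sinv (val y) \<cdot> (val u \<cdot> sinv (val u)) = val u \<cdot> sinv (val u)"
  shows "\<exists>z. is_residual perrot_graph u y z"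
proof -
  note yv = val_path_elem[OF y] and uv = val_path_elem[OF u]
  have yu: "val y \<cdot> sinv (val y) \<cdot> val u = val u"
    using le path_elem_closed[OF yv] path_elem_closed[OF uv] by (simp add: mult_ran_eq_iff closed)
  note q = path_elem_quotient[OF yv uv yu]
  then obtain z where z: "is_path perrot_graph z" "val z = sinv (val y) \<cdot> val u"
    using val_surj by blast
  have "path_ran perrot_graph z \<in> verts perrot_graph"
    using graph.path_ends z by blast
  \<comment> \<open>The range vertex of \<open>z\<close> is maximal and fixes \<open>val z\<close>,
    so by (P3) it is the roof.\<close>
  then have "roof (val z \<cdot> sinv (val z)) = path_ran perrot_graph z"
    using val_ran[OF z(1)] val_path_elem[OF z(1)] path_elem_closed
    by (intro roof_eqI)
       (auto simp: path_elem_ran_idem path_elem_ran_nonzero mult_ran_eq_iff maximal_idem idem_closed)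
  then have yz: "path_dom perrot_graph y = path_ran perrot_graph z"
    using z(2) path_elem_quotient_ran[OF yv uv yu] val_dom[OF y] by simp
  moreover have "u = y \<bullet> z"
    using val_inj[OF u is_path_comp[OF y z(1) yz]] val_comp[OF y z(1) yz] z(2)
      path_elem_quotient_mult[OF yv uv yu] by simp
  ultimately show ?thesis
    using z(1) by (auto simp: is_residual_def)
qed

section \<open>The isomorphism from fractions of paths\<close>

fun gis_val :: "('a, 'a) gis \<Rightarrow> 'a" where
  "gis_val Zero = \<bbbzero>"
| "gis_val (Frac x y) = val x \<cdot> sinv (val y)"

lemma val_closed: "is_path perrot_graph p \<Longrightarrow> val p \<in> carrier S"
  by (simp add: val_path_elem path_elem_closed)

lemma sinv_val_mult_val:
  assumes "is_path perrot_graph y" "is_residual perrot_graph u y z"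
  shows "sinv (val y) \<cdot> val u = val z"
proof -
  have z: "is_path perrot_graph z" "path_dom perrot_graph y = path_ran perrot_graph z" "u = y \<bullet> z"
    using assms by (auto simp: is_residual_def)
  have "sinv (val y) \<cdot> val u = sinv (val y) \<cdot> val y \<cdot> val z"
    using val_comp[OF assms(1) z(1,2)] z assms(1) by (simp add: val_closed closed mult_assoc)
  then show ?thesis
    using val_dom[OF assms(1)] val_ran[OF z(1)] z(2) by simp
qed

text \<open>A nonzero value forces the product of the two range idempotents to be nonzero. That
  product lies below both, so (P1) makes them comparable, and comparability means that one path is a
  prefix of the other.\<close>

lemma sinv_val_mult_val_nonzero:
  assumes "is_path perrot_graph y" "is_path perrot_graph u" "sinv (val y) \<cdot> val u \<noteq> \<bbbzero>"
  shows "(\<exists>z. is_residual perrot_graph u y z) \<or> (\<exists>z. is_residual perrot_graph y u z)"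
proof -
  note y = val_path_elem[OF assms(1)] and u = val_path_elem[OF assms(2)]
  note [simp] = path_elem_closed[OF y] path_elem_closed[OF u] closed
  let ?e = "val y \<cdot> sinv (val y)" and ?f = "val u \<cdot> sinv (val u)"
  note idem = path_elem_ran_idem[OF y] path_elem_ran_idem[OF u]
  have "sinv (val y) \<cdot> val u = sinv (val y) \<cdot> (?e \<cdot> ?f) \<cdot> val u"
    by (simp add: mult_assoc mult_sinv_mult sinv_mult_sinv_left)
  then have "?e \<cdot> ?f \<noteq> \<bbbzero>"
    using assms(3) zero_left zero_right by auto
  moreover have "?e \<cdot> (?e \<cdot> ?f) = ?e \<cdot> ?f"
    using idem by (simp add: idem_mult_left)
  moreover have "?f \<cdot> (?e \<cdot> ?f) = ?e \<cdot> ?f"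
    using idem idem_commute by (metis idem_mult_left idem_closed)
  ultimately have "?e \<cdot> ?f = ?f \<or> ?f \<cdot> ?e = ?e"
    using comparable idem idem_mult_closed by metis
  then show ?thesis
    using residual_if_le assms by blast
qed

lemma gis_val_hom:
  assumes "a \<in> carrier (graph_inverse_semigroup perrot_graph)"
    "b \<in> carrier (graph_inverse_semigroup perrot_graph)"
  shows "gis_val (gis_mult perrot_graph a b) = gis_val a \<cdot> gis_val b"
proof (cases "a = Zero \<or> b = Zero")
  case True
  have "gis_val c \<in> carrier S" if "c \<in> carrier (graph_inverse_semigroup perrot_graph)" for c
    using that by (auto simp: graph_inverse_semigroup_simps val_closed closed zero_closed)
  then show ?thesis
    using True assms by (auto simp: gis_mult_Zero_right zero_left zero_right)
next
  case False
  then obtain x y u v where ab: "a = Frac x y" "b = Frac u v"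
    and p: "is_path perrot_graph x" "is_path perrot_graph y" "is_path perrot_graph u"
      "is_path perrot_graph v"
    and d: "path_dom perrot_graph x = path_dom perrot_graph y"
      "path_dom perrot_graph u = path_dom perrot_graph v"
    using assms by (auto simp: graph_inverse_semigroup_simps)
  note [simp] = p[THEN val_closed] closed
  have prod: "gis_val a \<cdot> gis_val b = val x \<cdot> (sinv (val y) \<cdot> val u) \<cdot> sinv (val v)"
    by (simp add: ab mult_assoc)
  show ?thesis
  proof (cases "\<exists>z. is_residual perrot_graph u y z")
    case True
    then obtain z where z: "is_residual perrot_graph u y z" ..
    then have "gis_mult perrot_graph a b = Frac (x \<bullet> z) v"
      using True the_residual[OF p(2)] by (auto simp: ab)
    moreover have "val (x \<bullet> z) = val x \<cdot> val z"
      using z d by (intro val_comp p) (simp_all add: is_residual_def)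
    ultimately show ?thesis
      using prod sinv_val_mult_val[OF p(2) z] by simp
  next
    case none: False
    show ?thesis
    proof (cases "\<exists>z. is_residual perrot_graph y u z")
      case True
      then obtain z where z: "is_residual perrot_graph y u z" ..
      then have [simp]: "val z \<in> carrier S"
        by (simp add: is_residual_def val_closed)
      have "gis_mult perrot_graph a b = Frac x (v \<bullet> z)"
        using True none z the_residual[OF p(3)] by (auto simp: ab)
      moreover have "val (v \<bullet> z) = val v \<cdot> val z"
        using z d by (intro val_comp p) (simp_all add: is_residual_def)
      \<comment> \<open>Inverting reduces this case to the evaluation of a residual, now of
        \<open>y\<close> by \<open>u\<close>.\<close>
      moreover have "sinv (val y) \<cdot> val u = sinv (sinv (val u) \<cdot> val y)"
        by (simp add: sinv_mult)
      ultimately show ?thesis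
        using prod sinv_val_mult_val[OF p(3) z] by (simp add: sinv_mult mult_assoc)
    next
      case False
      then have "sinv (val y) \<cdot> val u = \<bbbzero>"
        using none sinv_val_mult_val_nonzero p by blast
      moreover have "gis_mult perrot_graph a b = Zero"
        using False none by (auto simp: ab)
      ultimately show ?thesis
        using prod by (simp add: zero_left zero_right)
    qed
  qed
qed

text \<open>Since the domains agree, the middle idempotent can be exchanged for that of the other
  path and absorbed. The value of a fraction thus determines the ranges of both path elements, and
  with them both paths.\<close>

lemma
  assumes "is_path perrot_graph x" "is_path perrot_graph y"
    "path_dom perrot_graph x = path_dom perrot_graph y"
  shows gis_val_ran: "gis_val (Frac x y) \<cdot> sinv (gis_val (Frac x y)) = val x \<cdot> sinv (val x)"
    and gis_val_dom: "sinv (gis_val (Frac x y)) \<cdot> gis_val (Frac x y) = val y \<cdot> sinv (val y)"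
proof -
  note [simp] = assms(1,2)[THEN val_closed] closed
  have d: "sinv (val y) \<cdot> val y = sinv (val x) \<cdot> val x"
    using assms by (simp add: val_dom)
  have "gis_val (Frac x y) \<cdot> sinv (gis_val (Frac x y))
      = val x \<cdot> (sinv (val y) \<cdot> val y) \<cdot> sinv (val x)"
    by (simp add: sinv_mult mult_assoc)
  then show "gis_val (Frac x y) \<cdot> sinv (gis_val (Frac x y)) = val x \<cdot> sinv (val x)"
    unfolding d by (simp add: mult_assoc mult_sinv_mult_left)
  have "sinv (gis_val (Frac x y)) \<cdot> gis_val (Frac x y)
      = val y \<cdot> (sinv (val x) \<cdot> val x) \<cdot> sinv (val y)"
    by (simp add: sinv_mult mult_assoc)
  then show "sinv (gis_val (Frac x y)) \<cdot> gis_val (Frac x y) = val y \<cdot> sinv (val y)"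
    unfolding d[symmetric] by (simp add: mult_assoc mult_sinv_mult_left)
qed

lemma gis_val_inj: "inj_on gis_val (carrier (graph_inverse_semigroup perrot_graph))"
proof -
  have nz: "val x \<cdot> sinv (val y) \<noteq> \<bbbzero>"
    if "is_path perrot_graph x" "is_path perrot_graph y"
      "path_dom perrot_graph x = path_dom perrot_graph y" for x y
    using gis_val_ran[OF that] path_elem_ran_nonzero[OF val_path_elem[OF that(1)]]
    by (auto simp: zero_left sinv_closed zero_closed)
  have eq: "x = u \<and> y = v"
    if x: "is_path perrot_graph x" "is_path perrot_graph y"
        "path_dom perrot_graph x = path_dom perrot_graph y"
      and u: "is_path perrot_graph u" "is_path perrot_graph v"
        "path_dom perrot_graph u = path_dom perrot_graph v"
      and eq: "gis_val (Frac x y) = gis_val (Frac u v)" for x y u v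
    using gis_val_ran[OF x] gis_val_ran[OF u] gis_val_dom[OF x] gis_val_dom[OF u] eq x u
      path_elem_eqI val_path_elem val_inj by metis
  show ?thesis
    by (intro inj_onI) (auto simp: graph_inverse_semigroup_simps nz nz[symmetric] dest: eq)
qed

lemma gis_val_image: "gis_val ` carrier (graph_inverse_semigroup perrot_graph) = carrier S"
proof (intro equalityI subsetI)
  fix s assume "s \<in> gis_val ` carrier (graph_inverse_semigroup perrot_graph)"
  then show "s \<in> carrier S"
    by (auto simp: graph_inverse_semigroup_simps val_closed closed zero_closed)
next
  fix s assume s: "s \<in> carrier S"
  show "s \<in> gis_val ` carrier (graph_inverse_semigroup perrot_graph)"
  proof (cases "s = \<bbbzero>")
    case True
    then show ?thesis
      by (auto simp: graph_inverse_semigroup_simps intro!: image_eqI[of _ _ Zero])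
  next
    case False
    then have "s \<cdot> sinv s \<in> idempotents S" "s \<cdot> sinv s \<noteq> \<bbbzero>"
      "sinv s \<cdot> s \<in> idempotents S" "sinv s \<cdot> s \<noteq> \<bbbzero>"
      using s by (simp_all add: mult_sinv_idem mult_sinv_eq_zero_iff sinv_mult_idem sinv_mult_eq_zero_iff)
    then obtain x where x: "x \<in> path_elems" "x \<cdot> sinv x = s \<cdot> sinv s"
      using path_elem_exists by metis
    note [simp] = path_elem_closed[OF x(1)] s closed
    \<comment> \<open>With \<open>x\<close> of the same range as \<open>s\<close>, this is the
      denominator: \<open>x \<cdot> sinv ?y\<close> equals
      \<open>x \<cdot> sinv x \<cdot> s\<close>, which is \<open>s\<close>.\<close>
    let ?y = "sinv s \<cdot> x"
    have sx: "s \<cdot> (sinv s \<cdot> x) = x"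
      using x(2) mult_sinv_mult[of x] by (metis mult_assoc path_elem_closed[OF x(1)] s sinv_closed)
    then have dom: "sinv ?y \<cdot> ?y = sinv x \<cdot> x"
      by (simp add: sinv_mult mult_assoc)
    then have "?y \<noteq> \<bbbzero>"
      using path_elem_dom_nonzero[OF x(1)] sinv_mult_eq_zero_iff[of ?y] by auto
    then have y: "?y \<in> path_elems"
      using dom path_elem_maximal[OF x(1)] by (simp add: path_elems_def)
    obtain p q where p: "is_path perrot_graph p" "val p = x" and q: "is_path perrot_graph q" "val q = ?y"
      using val_surj x(1) y by meson
    have "path_dom perrot_graph p = path_dom perrot_graph q"
      using val_dom p q dom by metis
    moreover have "gis_val (Frac p q) = s"
    proof -
      have "gis_val (Frac p q) = x \<cdot> sinv x \<cdot> s"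
        using p q by (simp add: sinv_mult mult_assoc)
      then show ?thesis
        by (simp add: x(2) mult_assoc mult_sinv_mult)
    qed
    ultimately show ?thesis
      using p q by (auto simp: graph_inverse_semigroup_simps simp del: gis_val.simps
          intro!: image_eqI[of _ _ "Frac p q"])
  qed
qed

lemma isomorphic_perrot_graph: "semigroup_isomorphic S (graph_inverse_semigroup perrot_graph)"
proof -
  let ?P = "carrier (graph_inverse_semigroup perrot_graph)"
  let ?h = "inv_into ?P gis_val"
  have bij: "bij_betw gis_val ?P (carrier S)"
    using gis_val_inj gis_val_image by (simp add: bij_betw_def)
  have "?h (a \<cdot> b) = gis_mult perrot_graph (?h a) (?h b)"
    if "a \<in> carrier S" "b \<in> carrier S" for a b
  proof -
    have h: "?h a \<in> ?P" "?h b \<in> ?P" "gis_val (?h a) = a" "gis_val (?h b) = b"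
      using that gis_val_image by (auto intro: inv_into_into f_inv_into_f)
    then show ?thesis
      using gis_val_hom[OF h(1,2)] inv_into_f_f[OF gis_val_inj gis_mult_closed[OF h(1,2)]] by simp
  qed
  then show ?thesis
    unfolding semigroup_isomorphic_def graph_inverse_semigroup_simps(2)
    using bij_betw_inv_into[OF bij] by blast
qed

end

text \<open>The types of vertices and edges are arbitrary here, so that both conjuncts of the final
  theorem can use it.\<close>

lemma isomorphic_graph_inverse_semigroupD:
  fixes S :: "('a, 'b) semigroup_zero_scheme" and G :: "('v, 'e) pre_digraph"
  assumes "inverse_semigroup_zero S" "wf_digraph G"
    "semigroup_isomorphic S (graph_inverse_semigroup G)"
  shows "combinatorial S \<and> proper_perrot_semigroup S"
proof -
  obtain h where "gis_isomorphism S G h"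
    using assms unfolding semigroup_isomorphic_def graph_inverse_semigroup_simps(2)
    by (auto simp: gis_isomorphism_def gis_isomorphism_axioms_def)
  then show ?thesis
    using gis_isomorphism.combinatorial gis_isomorphism.proper_perrot by blast
qed

text \<open>In the equivalence the graph may be taken over the type of \<open>S\<close>, because its
  vertices and edges are elements of \<open>S\<close>. The second conjunct extends the forward
  direction to graphs over any types.\<close>

theorem theorem2p1:
  fixes S :: "'a semigroup_zero"
  assumes "inverse_semigroup_zero S"
  shows "((\<exists>G :: ('a, 'a) pre_digraph. wf_digraph G \<and>
              semigroup_isomorphic S (graph_inverse_semigroup G))
            \<longleftrightarrow> combinatorial S \<and> proper_perrot_semigroup S)
       \<and> (\<forall>G :: ('v, 'e) pre_digraph. wf_digraph G \<and>
              semigroup_isomorphic S (graph_inverse_semigroup G)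
            \<longrightarrow> combinatorial S \<and> proper_perrot_semigroup S)"
proof (intro conjI iffI allI impI; (elim exE conjE)?)
  assume "combinatorial S" "proper_perrot_semigroup S"
  then interpret combinatorial_proper_perrot S
    by (simp add: combinatorial_proper_perrot_def combinatorial_proper_perrot_axioms_def)
  show "\<exists>G :: ('a, 'a) pre_digraph. wf_digraph G \<and>
      semigroup_isomorphic S (graph_inverse_semigroup G)"
    using graph.wf_digraph_axioms isomorphic_perrot_graph by blast
qed (use isomorphic_graph_inverse_semigroupD[OF assms] in blast)+

end
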